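(* (i) Every finite graph $G$ with maximum degree at most $3$ is isomorphic to the intersection graph of a finite set of distinct lines in $\mathbb{P}^3$. (ii) For every finite graph $G$, the line graph of $G$ is isomorphic to the intersection graph of a finite set of distinct lines in $\mathbb{P}^3$.
   Context: The intersection graph of a family of sets is the graph whose vertices are the members, two adjacent iff the corresponding sets intersect. The line graph of $G$ has vertex set $E(G)$, two edges adjacent iff they share an endpoint. $\mathbb{P}^3$ is real projective 3-space. *)

theory Defs
  imports "HOL-Analysis.Analysis"
begin

record 'a graph =
  verts :: "'a set"
  edges :: "'a set set"

definition finite_graph :: "'a graph \<Rightarrow> bool" where
  "finite_graph G \<longleftrightarrow> finite (verts G) \<and> (\<forall>e\<in>edges G. e \<subseteq> verts G \<and> card e = 2)"

definition degree :: "'a graph \<Rightarrow> 'a \<Rightarrow> nat" where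
  "degree G v = card {e \<in> edges G. v \<in> e}"

text \<open>The supremum of the empty set of naturals is \<open>0\<close>, so the graph without vertices has
  maximum degree \<open>0\<close>.\<close>

definition max_degree :: "'a graph \<Rightarrow> nat" where
  "max_degree G = (SUP v\<in>verts G. degree G v)"

definition graph_iso :: "'a graph \<Rightarrow> 'b graph \<Rightarrow> bool" where
  "graph_iso G H \<longleftrightarrow> (\<exists>f. bij_betw f (verts G) (verts H) \<and>
     (\<forall>u\<in>verts G. \<forall>v\<in>verts G. {u, v} \<in> edges G \<longleftrightarrow> {f u, f v} \<in> edges H))"

definition intersection_graph :: "'a set set \<Rightarrow> 'a set graph" where
  "intersection_graph F =
     \<lparr>verts = F, edges = {{A, B} | A B. A \<in> F \<and> B \<in> F \<and> A \<noteq> B \<and> A \<inter> B \<noteq> {}}\<rparr>"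

definition line_graph :: "'a graph \<Rightarrow> 'a set graph" where
  "line_graph G =
     \<lparr>verts = edges G,
      edges = {{e, e'} | e e'. e \<in> edges G \<and> e' \<in> edges G \<and> e \<noteq> e' \<and> (\<exists>v. v \<in> e \<and> v \<in> e')}\<rparr>"

text \<open>Points of real projective 3-space are the one-dimensional subspaces of \<open>\<real>\<^sup>4\<close>; a projective
  line is the set of all points contained in some fixed two-dimensional subspace. Hence two lines
  intersect as sets iff they have a common projective point.\<close>

definition proj_points :: "(real^4) set set" where
  "proj_points = {p. subspace p \<and> dim p = 1}"

definition proj_line :: "(real^4) set set \<Rightarrow> bool" where
  "proj_line l \<longleftrightarrow> (\<exists>W. subspace W \<and> dim W = 2 \<and> l = {p \<in> proj_points. p \<subseteq> W})"

end

(*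
Represent a line of projective 3-space by its Pluecker vector in R^6; two lines meet iff their vectors
are orthogonal for the Klein form.

For line graphs, put the vertices of G on the moment curve, where four distinct points are never
coplanar, and send an edge to the line joining its ends.

For maximum degree 3, build the configuration by induction, keeping it generic: no four pairwise skew
lines lie in a common regulus. A vertex with pairwise nonadjacent neighbours is added as a common
transversal of three skew lines (isolated dummy lines fill up missing neighbours). The transversals
form a conic spanning a three-dimensional space W of Pluecker vectors, so a generic one avoids any
line d unless d is orthogonal to W, that is, lies in the regulus of the three; and genericity
survives unless W is spanned by three old lines, which would give a neighbour degree at least 4.
If two adjacent vertices have two common nonadjacent neighbours c and d, both are added
simultaneously as lines joining one point of d to two points of c. The only remaining obstacle is a
triangle or a K4 whose vertices have distinct outer neighbours: it is added as a star of lines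
through one generic point, each meeting the line of its outer neighbour. Every genericity condition
says that a polynomial in one parameter is not identically zero.
*)
theory Submission
  imports Defs "HOL-Computational_Algebra.Polynomial"
begin

section \<open>Pluecker vectors and the Klein form\<close>

type_synonym pvec = "real \<times> real \<times> real \<times> real \<times> real \<times> real"

text \<open>Coordinates are listed in the order 12, 13, 14, 23, 24, 34, and the form below is normalised so
  that its value on \<open>pluecker x y\<close> and \<open>pluecker z w\<close> is the determinant with rows \<open>x, y, z, w\<close>.\<close>

definition pluecker :: "real^4 \<Rightarrow> real^4 \<Rightarrow> pvec" where
  "pluecker x y =
    (x$1 * y$2 - x$2 * y$1, x$1 * y$3 - x$3 * y$1, x$1 * y$4 - x$4 * y$1,
     x$2 * y$3 - x$3 * y$2, x$2 * y$4 - x$4 * y$2, x$3 * y$4 - x$4 * y$3)"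

fun klein :: "pvec \<Rightarrow> pvec \<Rightarrow> real" where
  "klein (p12, p13, p14, p23, p24, p34) (q12, q13, q14, q23, q24, q34) =
    p12 * q34 - p13 * q24 + p14 * q23 + p23 * q14 - p24 * q13 + p34 * q12"

lemma klein_commute: "klein p q = klein q p"
  by (cases p; cases q) simp

lemma klein_add_left: "klein (p + p') q = klein p q + klein p' q"
  by (cases p; cases p'; cases q) (simp add: algebra_simps)

lemma klein_scaleR_left: "klein (c *\<^sub>R p) q = c * klein p q"
  by (cases p; cases q) (simp add: algebra_simps)

lemma klein_add_right: "klein q (p + p') = klein q p + klein q p'"
  by (metis klein_add_left klein_commute)

lemma klein_scaleR_right: "klein q (c *\<^sub>R p) = c * klein q p"
  by (metis klein_scaleR_left klein_commute)

lemma klein_zero_left [simp]: "klein 0 q = 0"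
  by (metis klein_scaleR_left mult_zero_left scaleR_zero_left)

lemma klein_zero_right [simp]: "klein q 0 = 0"
  by (metis klein_commute klein_zero_left)

lemma klein_minus_right: "klein q (- p) = - klein q p"
  by (cases p; cases q) simp

lemmas klein_linear = klein_add_left klein_scaleR_left klein_add_right klein_scaleR_right

lemma pluecker_add_left: "pluecker (x + x') y = pluecker x y + pluecker x' y"
  and pluecker_scaleR_left: "pluecker (c *\<^sub>R x) y = c *\<^sub>R pluecker x y"
  and pluecker_add_right: "pluecker y (x + x') = pluecker y x + pluecker y x'"
  and pluecker_scaleR_right: "pluecker y (c *\<^sub>R x) = c *\<^sub>R pluecker y x"
  by (simp_all add: pluecker_def algebra_simps)

lemmas pluecker_linear =
  pluecker_add_left pluecker_scaleR_left pluecker_add_right pluecker_scaleR_right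

lemma pluecker_self [simp]: "pluecker x x = 0"
  by (simp add: pluecker_def zero_prod_def)

lemma pluecker_swap: "pluecker y x = - pluecker x y"
  by (simp add: pluecker_def)

lemma klein_pluecker_repeat [simp]:
  "klein (pluecker x y) (pluecker x z) = 0" "klein (pluecker x y) (pluecker z x) = 0"
  "klein (pluecker y x) (pluecker x z) = 0" "klein (pluecker y x) (pluecker z x) = 0"
  by (simp_all add: pluecker_def algebra_simps)

lemma klein_pluecker_swap:
  "klein (pluecker x z) (pluecker y w) = - klein (pluecker x y) (pluecker z w)"
  by (simp add: pluecker_def algebra_simps)

text \<open>Cramer's rule with the denominator cleared: each coefficient is the determinant with one
  row replaced by \<open>u\<close>. In this form it also holds when the determinant vanishes, and
  then it is a linear dependence.\<close>

lemma cramer: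
  "klein (pluecker x y) (pluecker z w) *\<^sub>R u =
    klein (pluecker u y) (pluecker z w) *\<^sub>R x + klein (pluecker x u) (pluecker z w) *\<^sub>R y +
    klein (pluecker x y) (pluecker u w) *\<^sub>R z + klein (pluecker x y) (pluecker z u) *\<^sub>R w"
  by (simp add: vec_eq_iff forall_4 pluecker_def algebra_simps)

text \<open>If \<open>x, y, z, w\<close> is a basis, the six Pluecker vectors on the right form a basis of the space of
  bivectors, and the coefficients are read off from the dual basis with respect to the Klein form.\<close>

lemma pluecker_expansion:
  "klein (pluecker x y) (pluecker z w) *\<^sub>R e =
    klein e (pluecker z w) *\<^sub>R pluecker x y - klein e (pluecker y w) *\<^sub>R pluecker x z +
    klein e (pluecker y z) *\<^sub>R pluecker x w + klein e (pluecker x w) *\<^sub>R pluecker y z -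
    klein e (pluecker x z) *\<^sub>R pluecker y w + klein e (pluecker x y) *\<^sub>R pluecker z w"
  by (cases e) (simp add: pluecker_def algebra_simps)

text \<open>The bivector of two unit vectors picks out a single coordinate of \<open>e\<close> up to
  sign.\<close>

lemma klein_pluecker_nondegenerate:
  assumes "e \<noteq> 0" obtains x y where "klein e (pluecker x y) \<noteq> 0"
proof (rule ccontr)
  assume "\<not> thesis"
  then have z: "klein e (pluecker (axis i 1) (axis j 1)) = 0" for i j
    using that by blast
  obtain a b c d f g where "e = (a, b, c, d, f, g)" by (cases e)
  then have "e = 0"
    using z[of 1 2] z[of 1 3] z[of 1 4] z[of 2 3] z[of 2 4] z[of 3 4]
    by (simp add: pluecker_def axis_def zero_prod_def)
  with assms show False ..
qed

text \<open>The nonzero decomposable bivectors, without normalisation: two of them give the same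
  line iff they are proportional, so distinctness of lines is expressed below through
  \<open>span {x}\<close>.\<close>

definition klines :: "pvec set" where
  "klines = {pluecker x y | x y. pluecker x y \<noteq> 0}"

lemma klinesE:
  assumes "p \<in> klines" obtains x y where "p = pluecker x y" "pluecker x y \<noteq> 0"
  using assms by (auto simp: klines_def)

lemma klines_nonzero: "p \<in> klines \<Longrightarrow> p \<noteq> 0"
  by (auto simp: klines_def)

lemma klein_klines_self [simp]: "p \<in> klines \<Longrightarrow> klein p p = 0"
  by (auto simp: klines_def)

lemma pluecker_in_klines: "klein (pluecker x y) e \<noteq> 0 \<Longrightarrow> pluecker x y \<in> klines"
  unfolding klines_def by force

section \<open>Incidence of points and lines through determinants\<close>

lemma in_span_2: "(v::'v::real_vector) \<in> span {x, y} \<longleftrightarrow> (\<exists>a b. v = a *\<^sub>R x + b *\<^sub>R y)"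
proof -
  have "v - a *\<^sub>R x - b *\<^sub>R y = 0 \<longleftrightarrow> v = a *\<^sub>R x + b *\<^sub>R y" for a b
    by (simp add: diff_diff_eq)
  then show ?thesis by (simp add: span_breakdown_eq)
qed

lemma in_span_3:
  "(v::'v::real_vector) \<in> span {x, y, z} \<longleftrightarrow> (\<exists>a b c. v = a *\<^sub>R x + b *\<^sub>R y + c *\<^sub>R z)"
proof -
  have "v - a *\<^sub>R x - b *\<^sub>R y - c *\<^sub>R z = 0 \<longleftrightarrow> v = a *\<^sub>R x + b *\<^sub>R y + c *\<^sub>R z" for a b c
    by (simp add: diff_diff_eq)
  then show ?thesis by (simp add: span_breakdown_eq)
qed

lemma klein_span_eq_0:
  assumes "v \<in> span S" "\<And>x. x \<in> S \<Longrightarrow> klein t x = 0" shows "klein t v = 0"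
  using assms(1) by (induction rule: span_induct_alt) (auto simp: klein_linear assms(2))

text \<open>Every determinant with rows \<open>x, y, z, u\<close> vanishes. After
  \<open>x, y\<close> is completed to a basis by some \<open>e, f\<close>, Cramer's rule leaves
  \<open>z\<close> no component along \<open>e\<close> and \<open>f\<close>.\<close>

lemma point_on_line:
  assumes nz: "pluecker x y \<noteq> 0" and "\<And>u. klein (pluecker x y) (pluecker z u) = 0"
  shows "z \<in> span {x, y}"
proof -
  obtain e f where D: "klein (pluecker x y) (pluecker e f) \<noteq> 0"
    using klein_pluecker_nondegenerate[OF nz] .
  have "klein (pluecker x y) (pluecker e z) = 0"
    using assms(2)[of e] by (simp add: pluecker_swap[of e z] klein_minus_right)
  then have "klein (pluecker x y) (pluecker e f) *\<^sub>R z =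
      klein (pluecker z y) (pluecker e f) *\<^sub>R x + klein (pluecker x z) (pluecker e f) *\<^sub>R y"
    using cramer[of x y e f z] assms(2) by simp
  then have "klein (pluecker x y) (pluecker e f) *\<^sub>R z \<in> span {x, y}"
    unfolding in_span_2 by blast
  then show ?thesis
    using D by (auto dest: span_scale[where c = "inverse (klein (pluecker x y) (pluecker e f))"])
qed

lemma pluecker_span:
  assumes "z \<in> span {x, y}" "w \<in> span {x, y}" shows "pluecker z w \<in> span {pluecker x y}"
proof -
  obtain a b c d where z: "z = a *\<^sub>R x + b *\<^sub>R y" "w = c *\<^sub>R x + d *\<^sub>R y"
    using assms by (auto simp: in_span_2)
  have "pluecker z w = (a * d - b * c) *\<^sub>R pluecker x y"
    unfolding z by (simp add: pluecker_linear pluecker_swap[of y x] algebra_simps)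
  then show ?thesis by (auto simp: span_singleton)
qed

lemma meet_point:
  assumes "klein (pluecker x y) (pluecker z w) = 0" "pluecker x y \<noteq> 0" "pluecker z w \<noteq> 0"
  obtains v where "v \<noteq> 0" "v \<in> span {x, y}" "v \<in> span {z, w}"
proof (cases "\<forall>u. klein (pluecker x y) (pluecker z u) = 0")
  case True
  then have "z \<in> span {x, y}" using point_on_line assms(2) by blast
  moreover have "z \<noteq> 0" using assms(3) by (auto simp: pluecker_def zero_prod_def)
  ultimately show ?thesis using that by (auto intro: span_base)
next
  case False
  then obtain u where u: "klein (pluecker x y) (pluecker z u) \<noteq> 0" by blast
  \<comment> \<open>In Cramer's identity for \<open>u\<close> the left side is zero, so the part in
    \<open>z, w\<close>, which is \<open>v\<close>, is also a combination of
    \<open>x, y\<close>.\<close>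
  define v where "v = klein (pluecker x y) (pluecker u w) *\<^sub>R z + klein (pluecker x y) (pluecker z u) *\<^sub>R w"
  have "v = (- klein (pluecker u y) (pluecker z w)) *\<^sub>R x + (- klein (pluecker x u) (pluecker z w)) *\<^sub>R y"
    using cramer[of x y z w u] assms(1) unfolding v_def
    by (simp add: algebra_simps) (metis add.assoc add.commute add_eq_0_iff)
  then have "v \<in> span {x, y}" unfolding in_span_2 by blast
  moreover have "v \<in> span {z, w}" unfolding in_span_2 v_def by blast
  moreover have "v \<noteq> 0"
  proof
    assume "v = 0"
    then have "pluecker z v = 0" by (simp add: pluecker_def zero_prod_def)
    then have "klein (pluecker x y) (pluecker z u) *\<^sub>R pluecker z w = 0"
      by (simp add: v_def pluecker_linear)
    with u assms(3) show False by simp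
  qed
  ultimately show ?thesis using that by blast
qed

text \<open>Putting \<open>v\<close> in place of \<open>x\<close> or \<open>y\<close> multiplies the
  determinant by a coordinate of \<open>v\<close>, and also makes it zero, as \<open>v\<close>
  depends on \<open>z, w\<close>. One of the two coordinates is nonzero.\<close>

lemma meet_klein:
  assumes "v \<noteq> 0" "v \<in> span {x, y}" "v \<in> span {z, w}"
  shows "klein (pluecker x y) (pluecker z w) = 0"
proof -
  obtain a b c d where v: "v = a *\<^sub>R x + b *\<^sub>R y" "v = c *\<^sub>R z + d *\<^sub>R w"
    using assms(2,3) unfolding in_span_2 by blast
  have "klein (pluecker v y) (pluecker z w) = a * klein (pluecker x y) (pluecker z w)"
    "klein (pluecker x v) (pluecker z w) = b * klein (pluecker x y) (pluecker z w)"
    by (simp_all add: v(1) pluecker_linear klein_linear)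
  moreover have "klein (pluecker v y) (pluecker z w) = 0" "klein (pluecker x v) (pluecker z w) = 0"
    by (simp_all add: v(2) pluecker_linear klein_linear)
  moreover have "a \<noteq> 0 \<or> b \<noteq> 0" using assms(1) v(1) by auto
  ultimately show ?thesis by auto
qed

section \<open>Generic lines in one-parameter families\<close>

lemma poly_cofinite:
  assumes "(p :: real poly) \<noteq> 0" shows "\<forall>\<^sub>F s in cofinite. poly p s \<noteq> 0"
  using poly_roots_finite[OF assms] by (simp add: eventually_cofinite)

lemma cofinite_ex:
  assumes "\<forall>\<^sub>F s in cofinite. P (s::real)" obtains s where "P s"
proof -
  have "\<exists>s. P s"
    by (rule eventually_happens'[OF _ assms]) (simp add: infinite_UNIV_char_0)
  then show ?thesis using that by blast
qed

lemma linear_cofinite: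
  "a \<noteq> 0 \<or> b \<noteq> 0 \<Longrightarrow> \<forall>\<^sub>F s in cofinite. a + s * b \<noteq> (0::real)"
  using poly_cofinite[of "[:a, b:]"] by simp

text \<open>The curve has two uses: its points with distinct parameters are in general position, and
  \<open>moment s\<close> for generic \<open>s\<close> is a generic point of the space.\<close>

definition moment :: "real \<Rightarrow> real^4" where
  "moment s = vector [1, s, s^2, s^3]"

lemma vector_4_component [simp]:
  "(vector [a, b, c, d] :: 'v::zero^4) $ 1 = a" "(vector [a, b, c, d] :: 'v::zero^4) $ 2 = b"
  "(vector [a, b, c, d] :: 'v::zero^4) $ 3 = c" "(vector [a, b, c, d] :: 'v::zero^4) $ 4 = d"
  by (simp_all add: vector_def)

text \<open>The value is a linear form in \<open>u\<close>. Along the curve its four coefficients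
  become those of a polynomial in \<open>s\<close>, which is zero only if the form is.\<close>

lemma moment_cofinite:
  assumes "klein (pluecker u q) e \<noteq> 0"
  shows "\<forall>\<^sub>F s in cofinite. klein (pluecker (moment s) q) e \<noteq> 0"
proof -
  obtain a b c d f g where e: "e = (a, b, c, d, f, g)" by (cases e)
  define p where "p =
    [:q$2 * g - q$3 * f + q$4 * d, - (q$1 * g) + q$3 * c - q$4 * b,
      q$1 * f - q$2 * c + q$4 * a, - (q$1 * d) + q$2 * b - q$3 * a:]"
  have "klein (pluecker x q) e = x$1 * coeff p 0 + x$2 * coeff p 1 + x$3 * coeff p 2 + x$4 * coeff p 3" for x
    by (simp add: p_def e pluecker_def algebra_simps numeral_2_eq_2 numeral_3_eq_3)
  note * = this
  have "klein (pluecker (moment s) q) e = poly p s" for s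
    by (simp add: moment_def p_def e pluecker_def algebra_simps power2_eq_square power3_eq_cube)
  moreover have "p \<noteq> 0" using assms * by auto
  ultimately show ?thesis using poly_cofinite by simp
qed

lemma pencil_cofinite:
  assumes "klein (pluecker p q1) e \<noteq> 0 \<or> klein (pluecker p q2) e \<noteq> 0"
  shows "\<forall>\<^sub>F r in cofinite. klein (pluecker p (q1 + r *\<^sub>R q2)) e \<noteq> 0"
  using linear_cofinite[OF assms] by (simp add: pluecker_linear klein_linear)

text \<open>If the value were zero for all \<open>u\<close> and both \<open>q = m1\<close> and
  \<open>q = m2\<close>, both points would lie on \<open>e\<close>, and the line joining them would
  be \<open>e\<close>. The order of the quantifiers lets many lines share one point
  \<open>moment s\<close> while each has its own \<open>r\<close>.\<close>

lemma star_cofinite: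
  assumes "e \<in> klines" "pluecker m1 m2 \<notin> span {e}"
  shows "\<forall>\<^sub>F s in cofinite. \<forall>\<^sub>F r in cofinite. klein (pluecker (moment s) (m1 + r *\<^sub>R m2)) e \<noteq> 0"
proof -
  obtain x y where e: "e = pluecker x y" "pluecker x y \<noteq> 0" using assms(1) by (rule klinesE)
  have "\<exists>u q. q \<in> {m1, m2} \<and> klein (pluecker u q) e \<noteq> 0"
  proof (rule ccontr)
    assume *: "\<not> ?thesis"
    have "q \<in> span {x, y}" if "q \<in> {m1, m2}" for q
    proof (rule point_on_line[OF e(2)])
      fix u show "klein (pluecker x y) (pluecker q u) = 0"
        using * that by (metis add.inverse_neutral e(1) klein_commute klein_minus_right pluecker_swap)
    qed
    then have "pluecker m1 m2 \<in> span {e}" unfolding e(1) by (intro pluecker_span) auto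
    with assms(2) show False ..
  qed
  then obtain u q where q: "q \<in> {m1, m2}" "klein (pluecker u q) e \<noteq> 0" by blast
  show ?thesis
    using moment_cofinite[OF q(2)]
    by (rule eventually_mono) (use q(1) in \<open>auto intro!: pencil_cofinite\<close>)
qed

text \<open>By the Pluecker expansion, a line meeting all four joins of \<open>d1, d2\<close> with
  \<open>c1, c2\<close> lies in the span of the two given skew lines. The Klein form is
  \<open>2 * a * b * klein D C\<close> there, so the only lines in that span are the two
  themselves.\<close>

lemma pair_cofinite:
  assumes "klein (pluecker d1 d2) (pluecker c1 c2) \<noteq> 0" "e \<in> klines"
    "e \<notin> span {pluecker d1 d2}" "e \<notin> span {pluecker c1 c2}"
  shows "\<forall>\<^sub>F s in cofinite. \<forall>\<^sub>F r in cofinite. klein (pluecker (d1 + s *\<^sub>R d2) (c1 + r *\<^sub>R c2)) e \<noteq> 0"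
proof -
  define D C where "D = pluecker d1 d2" and "C = pluecker c1 c2"
  have DD: "klein D D = 0" "klein C C = 0" "klein D C \<noteq> 0" "klein C D \<noteq> 0"
    using assms(1) by (auto simp: D_def C_def klein_commute)
  have "\<exists>q\<in>{c1, c2}. klein (pluecker d1 q) e \<noteq> 0 \<or> klein (pluecker d2 q) e \<noteq> 0"
  proof (rule ccontr)
    assume "\<not> ?thesis"
    then have "klein D C *\<^sub>R e = klein e C *\<^sub>R D + klein e D *\<^sub>R C"
      using pluecker_expansion[of d1 d2 c1 c2 e] by (simp add: klein_commute D_def C_def)
    then have "e = (1 / klein D C) *\<^sub>R (klein e C *\<^sub>R D + klein e D *\<^sub>R C)"
      using DD(3) by (metis divide_self_if scaleR_one scaleR_scaleR times_divide_eq_left mult_1)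
    then obtain a b where e: "e = a *\<^sub>R D + b *\<^sub>R C" 
      by (metis scaleR_right_distrib scaleR_scaleR)
    have "klein e e = 2 * a * b * klein D C"
      unfolding e by (simp add: klein_linear DD klein_commute[of C D])
    then have "a = 0 \<or> b = 0" using assms(2) DD by simp
    then have "e \<in> span {D} \<or> e \<in> span {C}" unfolding e by (auto simp: span_singleton)
    with assms(3,4) show False by (simp add: D_def C_def)
  qed
  then obtain q where q: "q \<in> {c1, c2}" "klein (pluecker d1 q) e \<noteq> 0 \<or> klein (pluecker d2 q) e \<noteq> 0"
    by blast
  have "\<forall>\<^sub>F s in cofinite. klein (pluecker (d1 + s *\<^sub>R d2) q) e \<noteq> 0"
    using linear_cofinite[OF q(2)] by (simp add: pluecker_linear klein_linear)
  then show ?thesis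
    by (rule eventually_mono) (use q(1) in \<open>auto intro!: pencil_cofinite\<close>)
qed

section \<open>Three skew lines and their transversals\<close>

definition skew :: "pvec \<Rightarrow> pvec \<Rightarrow> pvec \<Rightarrow> bool" where
  "skew x y z \<longleftrightarrow> klein x y \<noteq> 0 \<and> klein x z \<noteq> 0 \<and> klein y z \<noteq> 0"

lemma klein_through:
  "z \<in> span {c1, c2} \<Longrightarrow> klein (pluecker x z) (pluecker c1 c2) = 0"
  "z \<in> span {c1, c2} \<Longrightarrow> klein (pluecker z x) (pluecker c1 c2) = 0"
  by (auto simp: in_span_2 pluecker_linear klein_linear)

text \<open>Write each point of \<open>a\<close> as a sum of a point of \<open>b\<close> and a point of \<open>c\<close>; joining the two summands
  gives the regulus \<open>v\<close> of common transversals. It is a conic that spans the orthogonal complement of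
  \<open>a, b, c\<close>.\<close>

lemma regulus_cofinite:
  assumes K: "a \<in> klines" "b \<in> klines" "c \<in> klines" and "skew a b c"
  obtains v where "\<And>s. klein (v s) a = 0" "\<And>s. klein (v s) b = 0" "\<And>s. klein (v s) c = 0"
    "\<And>s. \<exists>x y. v s = pluecker x y"
    "\<And>e. e \<notin> span {a, b, c} \<Longrightarrow> \<forall>\<^sub>F s::real in cofinite. klein (v s) e \<noteq> 0"
proof -
  obtain a1 a2 where a: "a = pluecker a1 a2" using K(1) by (rule klinesE)
  obtain b1 b2 where b: "b = pluecker b1 b2" using K(2) by (rule klinesE)
  obtain c1 c2 where c: "c = pluecker c1 c2" using K(3) by (rule klinesE)
  have sk: "klein a b \<noteq> 0" "klein a c \<noteq> 0" "klein b c \<noteq> 0"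
    using assms(4) by (auto simp: skew_def)
  have decomp: "\<exists>x z. x \<in> span {b1, b2} \<and> z \<in> span {c1, c2} \<and> u = x + z" for u
  proof -
    let ?x = "klein (pluecker u b2) c *\<^sub>R b1 + klein (pluecker b1 u) c *\<^sub>R b2"
    let ?z = "klein b (pluecker u c2) *\<^sub>R c1 + klein b (pluecker c1 u) *\<^sub>R c2"
    have "?x \<in> span {b1, b2}" "?z \<in> span {c1, c2}" unfolding in_span_2 by blast+
    moreover have "u = (1 / klein b c) *\<^sub>R ?x + (1 / klein b c) *\<^sub>R ?z"
    proof -
      have "u = (1 / klein b c) *\<^sub>R (klein b c *\<^sub>R u)" using sk by simp
      also have "klein b c *\<^sub>R u = ?x + ?z"
        using cramer[of b1 b2 c1 c2 u] by (simp add: b c)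
      finally show ?thesis by (simp only: scaleR_right_distrib)
    qed
    ultimately show ?thesis by (meson span_scale)
  qed
  obtain x1 z1 where 1: "x1 \<in> span {b1, b2}" "z1 \<in> span {c1, c2}" "a1 = x1 + z1" using decomp by blast
  obtain x2 z2 where 2: "x2 \<in> span {b1, b2}" "z2 \<in> span {c1, c2}" "a2 = x2 + z2" using decomp by blast
  obtain k where k: "pluecker x1 x2 = k *\<^sub>R b"
    using pluecker_span[OF 1(1) 2(1)] by (auto simp: b span_singleton)
  obtain l where l: "pluecker z1 z2 = l *\<^sub>R c"
    using pluecker_span[OF 1(2) 2(2)] by (auto simp: c span_singleton)
  \<comment> \<open>The pairs \<open>x1, x2\<close> and \<open>z1, z2\<close> span \<open>b\<close>
    and \<open>c\<close>, since otherwise \<open>a\<close> would meet \<open>c\<close> or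
    \<open>b\<close>. Hence the four vectors form a basis.\<close>
  have "klein a c = klein (pluecker x1 x2) c" "klein a b = klein (pluecker z1 z2) b"
    using 1(1,2) 2(1,2) by (simp_all add: a b c 1(3) 2(3) pluecker_linear klein_linear klein_through)
  then have nz: "k \<noteq> 0" "l \<noteq> 0" using sk by (auto simp: k l klein_linear)
  define D where "D = klein (pluecker x1 x2) (pluecker z1 z2)"
  have D: "D \<noteq> 0" using nz sk by (simp add: D_def k l klein_linear)
  define v where "v s = pluecker (x1 + s *\<^sub>R x2) (z1 + s *\<^sub>R z2)" for s
  have a': "a = pluecker x1 x2 + pluecker z1 z2 + (pluecker x1 z2 - pluecker x2 z1)"
    by (simp add: a 1(3) 2(3) pluecker_linear pluecker_swap[of z1 x2])
  have v: "v s = pluecker x1 z1 + s *\<^sub>R (pluecker x1 z2 + pluecker x2 z1) + s^2 *\<^sub>R pluecker x2 z2" for s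
    by (simp add: v_def pluecker_linear algebra_simps power2_eq_square)
  show thesis
  proof
    fix s
    have "v s = pluecker (x1 + s *\<^sub>R x2) (a1 + s *\<^sub>R a2)"
    proof -
      have "a1 + s *\<^sub>R a2 = (x1 + s *\<^sub>R x2) + (z1 + s *\<^sub>R z2)"
        by (simp add: 1(3) 2(3) algebra_simps)
      then show ?thesis by (simp only: v_def pluecker_add_right[of _ "x1 + s *\<^sub>R x2"] pluecker_self add_0)
    qed
    moreover have "a1 + s *\<^sub>R a2 \<in> span {a1, a2}" by (auto intro: span_add span_scale span_base)
    ultimately show "klein (v s) a = 0" by (simp add: a klein_through)
    show "klein (v s) b = 0" unfolding v_def b
      by (intro klein_through span_add span_scale 1 2)
    show "klein (v s) c = 0" unfolding v_def c
      by (intro klein_through span_add span_scale 1 2)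
    show "\<exists>x y. v s = pluecker x y" unfolding v_def by blast
  next
    fix e assume e: "e \<notin> span {a, b, c}"
    define p where "p = [:klein (pluecker x1 z1) e, klein (pluecker x1 z2) e + klein (pluecker x2 z1) e, klein (pluecker x2 z2) e:]"
    have p: "klein (v s) e = poly p s" for s
      by (simp add: v p_def klein_linear algebra_simps power2_eq_square)
    \<comment> \<open>If the quadratic vanished identically, three relations would hold among the
      six coefficients of \<open>e\<close> in the basis of bivectors; what remains is a combination
      of \<open>a\<close>, \<open>b\<close> and \<open>c\<close>.\<close>
    have "p \<noteq> 0"
    proof
      assume "p = 0"
      then have 0: "klein e (pluecker x1 z1) = 0" "klein e (pluecker x2 z2) = 0"
        "klein e (pluecker x1 z2) = - klein e (pluecker x2 z1)"
        by (auto simp: p_def klein_commute[of e])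
      let ?m = "klein e (pluecker x2 z1)"
      have "D *\<^sub>R e = klein e (pluecker z1 z2) *\<^sub>R pluecker x1 x2 +
          ?m *\<^sub>R (pluecker x1 z2 - pluecker x2 z1) + klein e (pluecker x1 x2) *\<^sub>R pluecker z1 z2"
        using pluecker_expansion[of x1 x2 z1 z2 e] by (simp add: D_def 0 algebra_simps)
      also have "pluecker x1 z2 - pluecker x2 z1 = a - k *\<^sub>R b - l *\<^sub>R c"
        by (simp add: a' k l)
      finally have "D *\<^sub>R e \<in> span {a, b, c}"
        by (simp add: k l span_add span_diff span_scale span_base)
      then show False using e D by (auto dest: span_scale[where c = "inverse D"])
    qed
    then show "\<forall>\<^sub>F s in cofinite. klein (v s) e \<noteq> 0"
      using poly_cofinite p by simp
  qed
qed

text \<open>The Gram matrix of \<open>a, b, c\<close> has zero diagonal and determinant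
  \<open>2 * p * q * r\<close>, so the Klein form is nondegenerate on their span.\<close>

lemma skew_independent:
  assumes "a \<in> klines" "b \<in> klines" "c \<in> klines" "skew a b c"
    "klein t a = 0" "klein t b = 0" "klein t c = 0" "t \<in> span {a, b, c}"
  shows "t = 0"
proof -
  obtain i j k where t: "t = i *\<^sub>R a + j *\<^sub>R b + k *\<^sub>R c" using assms(8) by (auto simp: in_span_3)
  define p q r where "p = klein a b" and "q = klein a c" and "r = klein b c"
  have s: "p \<noteq> 0" "q \<noteq> 0" "r \<noteq> 0"
    using assms(4) by (auto simp: skew_def p_def q_def r_def)
  have e: "j * p + k * q = 0" "i * p + k * r = 0" "i * q + j * r = 0"
    using assms(1-3,5-7) by (auto simp: t klein_linear klein_commute[of b a] klein_commute[of c a] klein_commute[of c b] p_def q_def r_def)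
  have "2 * (k * (q * r)) = r * (j * p + k * q) + q * (i * p + k * r) - p * (i * q + j * r)"
    by (simp add: algebra_simps)
  then have "k = 0" using e s by simp
  then show ?thesis using e s by (simp add: t)
qed

text \<open>The span of two skew lines contains no third line, because the Klein form vanishes there
  only on multiples of the two.\<close>

lemma skew_dim:
  assumes "a \<in> klines" "b \<in> klines" "c \<in> klines" "skew a b c"
  shows "dim {a, b, c} = 3"
proof -
  have n: "a \<noteq> b" "a \<noteq> c" "b \<noteq> c" using assms by (auto simp: skew_def)
  have "independent {a, b, c}"
  proof -
    have bc: "b \<noteq> k *\<^sub>R c" for k
      using assms by (auto simp: skew_def klein_linear)
    have abc: "a \<noteq> j *\<^sub>R b + k *\<^sub>R c" for j k
    proof
      assume a: "a = j *\<^sub>R b + k *\<^sub>R c"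
      have "klein a a = 0" using assms by simp
      then have "j * k = 0" using assms(2-4)
        unfolding a by (auto simp: klein_linear skew_def klein_commute[of c b])
      then show False using assms(2-4) unfolding a by (auto simp: klein_linear skew_def)
    qed
    show ?thesis
      using bc abc n klines_nonzero[OF assms(3)]
      by (auto simp: independent_insert in_span_2 span_singleton)
  qed
  then show ?thesis using n by (simp add: dim_eq_card_independent)
qed

text \<open>A nonzero transversal is orthogonal to \<open>a, b, c\<close>, hence outside their span
  by \<open>skew_independent\<close>, so almost every member of the family is skew to it. Three
  members are chosen one after another; the first exists because the span is not the whole
  six-dimensional space.\<close>

lemma transversals:
  assumes "a \<in> klines" "b \<in> klines" "c \<in> klines" "skew a b c"
  obtains t1 t2 t3 where "{t1, t2, t3} \<subseteq> klines" "skew t1 t2 t3"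
    "\<And>t x. t \<in> {t1, t2, t3} \<Longrightarrow> x \<in> {a, b, c} \<Longrightarrow> klein t x = 0"
proof -
  obtain v where v: "\<And>s. klein (v s) a = 0" "\<And>s. klein (v s) b = 0" "\<And>s. klein (v s) c = 0"
    "\<And>s. \<exists>x y. v s = pluecker x y"
    and g: "\<And>e. e \<notin> span {a, b, c} \<Longrightarrow> \<forall>\<^sub>F s::real in cofinite. klein (v s) e \<noteq> 0"
    using regulus_cofinite[OF assms] by blast
  have g': "\<forall>\<^sub>F s in cofinite. klein (v s) (v r) \<noteq> 0" if "v r \<noteq> 0" for r
    using that v skew_independent[OF assms] by (intro g) blast
  have "\<exists>e. e \<notin> span {a, b, c}"
  proof (rule ccontr)
    assume "\<not> ?thesis"
    then have "span {a, b, c} = UNIV" by blast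
    then have "dim {a, b, c} = DIM(pvec)" by (metis dim_UNIV dim_span)
    then show False using skew_dim[OF assms] by simp
  qed
  then obtain e where "e \<notin> span {a, b, c}" by blast
  then obtain r1 where "klein (v r1) e \<noteq> 0" using cofinite_ex[OF g] by blast
  then have 1: "v r1 \<noteq> 0" by auto
  obtain r2 where 2: "klein (v r2) (v r1) \<noteq> 0" using cofinite_ex[OF g'[OF 1]] .
  then have two: "v r2 \<noteq> 0" by auto
  obtain r3 where 3: "klein (v r3) (v r1) \<noteq> 0 \<and> klein (v r3) (v r2) \<noteq> 0"
    using cofinite_ex[OF eventually_conj[OF g'[OF 1] g'[OF two]]] .
  have "v r \<in> klines" if "v r \<noteq> 0" for r
    using v(4)[of r] that unfolding klines_def by (metis (mono_tags, lifting) mem_Collect_eq)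
  moreover have "v r3 \<noteq> 0" using 3 by (metis klein_zero_left)
  ultimately have "{v r1, v r2, v r3} \<subseteq> klines" using 1 two by simp
  then show thesis
  proof (rule that)
    show "skew (v r1) (v r2) (v r3)" using 2 3 klein_commute unfolding skew_def by metis
  qed (use v(1-3) in auto)
qed

section \<open>Generic configurations of lines\<close>

text \<open>Beyond distinctness of the lines, a good configuration has no four pairwise skew lines in a
  common regulus. This is the genericity that allows a new line to be attached to three old ones.\<close>

definition good :: "pvec set \<Rightarrow> bool" where
  "good L \<longleftrightarrow> L \<subseteq> klines \<and> (\<forall>x\<in>L. \<forall>y\<in>L. x \<noteq> y \<longrightarrow> y \<notin> span {x}) \<and>
    (\<forall>x\<in>L. \<forall>y\<in>L. \<forall>z\<in>L. \<forall>w\<in>L.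
      skew x y z \<and> klein w x \<noteq> 0 \<and> klein w y \<noteq> 0 \<and> klein w z \<noteq> 0 \<longrightarrow> w \<notin> span {x, y, z})"

lemma good_empty: "good {}"
  by (simp add: good_def)

lemma good_subset: "good L \<Longrightarrow> M \<subseteq> L \<Longrightarrow> good M"
  unfolding good_def subset_iff by meson

lemma goodD:
  assumes "good L"
  shows "x \<in> L \<Longrightarrow> x \<in> klines"
    and "x \<in> L \<Longrightarrow> y \<in> L \<Longrightarrow> x \<noteq> y \<Longrightarrow> y \<notin> span {x}"
    and "x \<in> L \<Longrightarrow> y \<in> L \<Longrightarrow> z \<in> L \<Longrightarrow> w \<in> L \<Longrightarrow> skew x y z \<Longrightarrow>
      klein w x \<noteq> 0 \<Longrightarrow> klein w y \<noteq> 0 \<Longrightarrow> klein w z \<noteq> 0 \<Longrightarrow> w \<notin> span {x, y, z}"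
  using assms unfolding good_def by blast+

lemma in_span_singleton_sym:
  assumes "x \<in> span {y}" "x \<noteq> (0::'v::real_vector)" shows "y \<in> span {x}"
proof -
  obtain k where k: "x = k *\<^sub>R y" using assms(1) by (auto simp: span_singleton)
  then have "y = inverse k *\<^sub>R x" using assms(2) by auto
  then show ?thesis by (auto simp: span_singleton)
qed

text \<open>Exchange property: without an \<open>x\<close>-component \<open>w\<close> would lie in
  the span of \<open>y, z\<close> and so be a multiple of one of them, against skewness. It allows
  any of four skew lines in a regulus to play the part of the dependent one.\<close>

lemma skew_span_swap:
  assumes "x \<in> klines" "w \<in> span {x, y, z}" "skew x y z"
    "klein w x \<noteq> 0" "klein w y \<noteq> 0" "klein w z \<noteq> 0"
    "y \<in> klines" "z \<in> klines" "w \<in> klines"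
  shows "x \<in> span {w, y, z}"
proof -
  obtain i j k where w: "w = i *\<^sub>R x + j *\<^sub>R y + k *\<^sub>R z" using assms(2) by (auto simp: in_span_3)
  have "i \<noteq> 0"
  proof
    assume "i = 0"
    then have w: "w = j *\<^sub>R y + k *\<^sub>R z" using w by simp
    have "klein w w = 0" using assms by simp
    then have "j * k = 0" using assms(3,7,8)
      unfolding w by (auto simp: klein_linear skew_def klein_commute[of z y])
    then show False using assms(5-8) unfolding w by (auto simp: klein_linear)
  qed
  then have "x = (1 / i) *\<^sub>R w + (- j / i) *\<^sub>R y + (- k / i) *\<^sub>R z"
    unfolding w by (simp add: scaleR_right_distrib)
  then show ?thesis unfolding in_span_3 by blast
qed

text \<open>The new lines meet pairwise, so four pairwise skew lines include at most one of them,
  and the exchange property makes it the dependent one. It therefore suffices to keep each new line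
  off the reguli of old lines.\<close>

lemma good_Un:
  assumes L: "good L" and W: "W \<subseteq> klines" "\<And>w w'. w \<in> W \<Longrightarrow> w' \<in> W \<Longrightarrow> klein w w' = 0"
    "\<And>w w'. w \<in> W \<Longrightarrow> w' \<in> W \<Longrightarrow> w \<noteq> w' \<Longrightarrow> w' \<notin> span {w}"
    "\<And>w l. w \<in> W \<Longrightarrow> l \<in> L \<Longrightarrow> w \<notin> span {l}"
    "\<And>w x y z. w \<in> W \<Longrightarrow> x \<in> L \<Longrightarrow> y \<in> L \<Longrightarrow> z \<in> L \<Longrightarrow> skew x y z \<Longrightarrow> w \<notin> span {x, y, z}"
  shows "good (L \<union> W)"
  unfolding good_def
proof (intro conjI ballI impI)
  show K: "L \<union> W \<subseteq> klines" using W(1) goodD(1)[OF L] by blast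
  {
    fix x y assume "x \<in> L \<union> W" "y \<in> L \<union> W" "x \<noteq> y"
    then consider "x \<in> L" "y \<in> L" | "x \<in> W" "y \<in> W" | "x \<in> W" "y \<in> L" | "x \<in> L" "y \<in> W" by blast
    then show "y \<notin> span {x}"
    proof cases
      case 1 then show ?thesis using goodD(2)[OF L] \<open>x \<noteq> y\<close> by blast
    next
      case 2 then show ?thesis using W(3) \<open>x \<noteq> y\<close> by blast
    next
      case 3 then show ?thesis
        using W(4) in_span_singleton_sym klines_nonzero goodD(1)[OF L] by blast
    next
      case 4 then show ?thesis using W(4) by blast
    qed
  }
  fix x y z w assume x: "x \<in> L \<union> W" "y \<in> L \<union> W" "z \<in> L \<union> W" "w \<in> L \<union> W"
    and "skew x y z \<and> klein w x \<noteq> 0 \<and> klein w y \<noteq> 0 \<and> klein w z \<noteq> 0"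
  then have s: "skew x y z" "klein w x \<noteq> 0" "klein w y \<noteq> 0" "klein w z \<noteq> 0" by auto
  then have s': "klein x y \<noteq> 0" "klein y x \<noteq> 0" "klein x z \<noteq> 0" "klein z x \<noteq> 0" "klein y z \<noteq> 0" "klein z y \<noteq> 0"
    "klein x w \<noteq> 0" "klein y w \<noteq> 0" "klein z w \<noteq> 0"
    by (auto simp: skew_def klein_commute)
  have k: "x \<in> klines" "y \<in> klines" "z \<in> klines" "w \<in> klines" using x K by auto
  show "w \<notin> span {x, y, z}"
  proof
    assume sp: "w \<in> span {x, y, z}"
    consider "x \<in> L" "y \<in> L" "z \<in> L" "w \<in> L" | "x \<in> L" "y \<in> L" "z \<in> L" "w \<in> W"
      | "x \<in> W" "y \<in> L" "z \<in> L" "w \<in> L" | "x \<in> L" "y \<in> W" "z \<in> L" "w \<in> L"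
      | "x \<in> L" "y \<in> L" "z \<in> W" "w \<in> L"
      using x s s' W(2) by blast
    then show False
    proof cases
      case 1 then show ?thesis using goodD(3)[OF L] s sp by blast
    next
      case 2 then show ?thesis using W(5) s sp by blast
    next
      case 3
      have "x \<in> span {w, y, z}" by (rule skew_span_swap) (use sp s k in auto)
      moreover have "skew w y z" using s s' by (auto simp: skew_def)
      ultimately show ?thesis using W(5) 3 by blast
    next
      case 4
      have "y \<in> span {w, x, z}"
        by (rule skew_span_swap) (use sp s s' k in \<open>auto simp: skew_def insert_commute\<close>)
      moreover have "skew w x z" using s s' by (auto simp: skew_def)
      ultimately show ?thesis using W(5) 4 by blast
    next
      case 5
      have "z \<in> span {w, x, y}"
        by (rule skew_span_swap) (use sp s s' k in \<open>auto simp: skew_def insert_commute\<close>)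
      moreover have "skew w x y" using s s' by (auto simp: skew_def)
      ultimately show ?thesis using W(5) 5 by blast
    qed
  qed
qed

lemma good_insert:
  assumes "good L" "w \<in> klines" "\<And>l. l \<in> L \<Longrightarrow> w \<notin> span {l}"
    "\<And>x y z. x \<in> L \<Longrightarrow> y \<in> L \<Longrightarrow> z \<in> L \<Longrightarrow> skew x y z \<Longrightarrow> w \<notin> span {x, y, z}"
  shows "good (insert w L)"
  using good_Un[of L "{w}"] assms by simp

lemma not_in_span_klein_self: "w \<in> klines \<Longrightarrow> l \<in> klines \<Longrightarrow> klein w l \<noteq> 0 \<Longrightarrow> w \<notin> span {l}"
  by (auto simp: span_singleton klein_linear)

text \<open>The exponents make the six Pluecker coordinates linearly independent polynomials in \<open>s\<close>.\<close>

definition curve :: "real \<Rightarrow> pvec" where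
  "curve s = pluecker (vector [1, 0, s, s^2]) (vector [0, 1, s^3, s^5])"

lemma curve_cofinite:
  assumes "e \<noteq> 0" shows "\<forall>\<^sub>F s in cofinite. klein (curve s) e \<noteq> 0"
proof -
  obtain a b c d f g where e: "e = (a, b, c, d, f, g)" by (cases e)
  have eq: "klein (curve s) e = poly [:g, - c, b, - f, 0, d - a, a:] s" for s
    by (simp add: curve_def e pluecker_def algebra_simps eval_nat_numeral)
  have "[:g, - c, b, - f, 0, d - a, a:] \<noteq> 0" using assms by (auto simp: e zero_prod_def)
  from poly_cofinite[OF this] show ?thesis by (simp only: eq)
qed

section \<open>Nested genericity conditions and certificates for avoiding a regulus\<close>

lemma eventually_eventually_ball:
  assumes "finite A" "\<And>a. a \<in> A \<Longrightarrow> \<forall>\<^sub>F s in F. \<forall>\<^sub>F r in G. P a s r"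
  shows "\<forall>\<^sub>F s in F. \<forall>\<^sub>F r in G. \<forall>a\<in>A. P a s r"
proof -
  have "\<forall>\<^sub>F s in F. \<forall>a\<in>A. \<forall>\<^sub>F r in G. P a s r"
    using assms by (intro eventually_ball_finite) auto
  then show ?thesis
    by (rule eventually_mono) (use assms(1) in \<open>auto intro: eventually_ball_finite\<close>)
qed

lemma eventually_eventually_conj:
  assumes "\<forall>\<^sub>F s in F. \<forall>\<^sub>F r in G. P s r" "\<forall>\<^sub>F s in F. \<forall>\<^sub>F r in G. Q s r"
  shows "\<forall>\<^sub>F s in F. \<forall>\<^sub>F r in G. P s r \<and> Q s r"
  using eventually_conj[OF assms] by (rule eventually_mono) (auto intro: eventually_conj)

lemma eventually_eventually_mono:
  assumes "\<forall>\<^sub>F s in F. \<forall>\<^sub>F r in G. P s r" "\<And>s r. P s r \<Longrightarrow> Q s r"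
  shows "\<forall>\<^sub>F s in F. \<forall>\<^sub>F r in G. Q s r"
  using assms(1) by (rule eventually_mono) (auto elim: eventually_mono intro: assms(2))

definition triples :: "pvec set \<Rightarrow> (pvec \<times> pvec \<times> pvec) set" where
  "triples L = {(x, y, z). x \<in> L \<and> y \<in> L \<and> z \<in> L \<and> skew x y z}"

lemma finite_triples: "finite L \<Longrightarrow> finite (triples L)"
  by (rule finite_subset[of _ "L \<times> L \<times> L"]) (auto simp: triples_def)

text \<open>A certificate \<open>t\<close> turns the condition of avoiding a span into the
  nonvanishing of one Klein product, which is polynomial in the parameter of a family.\<close>

lemma not_in_span_klein:
  assumes "klein w t \<noteq> 0" "\<And>x. x \<in> S \<Longrightarrow> klein t x = 0" shows "w \<notin> span S"
  using klein_span_eq_0[of w S t] assms by (auto simp: klein_commute)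

lemma in_span_skew:
  assumes "m \<in> span {t}" "m \<in> span {u}" "m \<in> klines" "t \<in> klines" "u \<in> klines" shows "klein t u = 0"
proof -
  obtain k where k: "m = k *\<^sub>R t" using assms by (auto simp: span_singleton)
  have "k \<noteq> 0" using k klines_nonzero[OF assms(3)] by auto
  obtain l where l: "m = l *\<^sub>R u" using assms by (auto simp: span_singleton)
  have "k * klein t u = klein m u" by (simp add: k klein_linear)
  also have "\<dots> = 0" using assms by (simp add: l klein_linear)
  finally show ?thesis using \<open>k \<noteq> 0\<close> by simp
qed

text \<open>Of three pairwise skew transversals at most one is the line \<open>m\<close> and at most
  one is \<open>n\<close>. The certificate must differ from \<open>m\<close> and \<open>n\<close>
  because the lines of the families in question all meet these two.\<close>

lemma transversal_avoiding:
  assumes "x \<in> klines" "y \<in> klines" "z \<in> klines" "skew x y z" "m \<in> klines" "n \<in> klines"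
  obtains t where "t \<in> klines" "\<And>u. u \<in> {x, y, z} \<Longrightarrow> klein t u = 0" "m \<notin> span {t}" "n \<notin> span {t}"
proof -
  obtain t1 t2 t3 where t: "{t1, t2, t3} \<subseteq> klines" "skew t1 t2 t3"
    "\<And>t x'. t \<in> {t1, t2, t3} \<Longrightarrow> x' \<in> {x, y, z} \<Longrightarrow> klein t x' = 0"
    using transversals[OF assms(1-4)] by metis
  have "\<not> (p \<in> span {t} \<and> p \<in> span {u})"
    if "p \<in> {m, n}" "t \<in> {t1, t2, t3}" "u \<in> {t1, t2, t3}" "klein t u \<noteq> 0" for p t u
    using in_span_skew[of p t u] that assms(5,6) t(1) by blast
  then have "\<exists>t\<in>{t1, t2, t3}. m \<notin> span {t} \<and> n \<notin> span {t}"
    using t(2) unfolding skew_def by (metis insertCI)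
  then show thesis using that t(1,3) by blast
qed

text \<open>Provides a certificate that a new line meeting \<open>m\<close> is not \<open>m\<close>
  itself.\<close>

lemma line_meeting:
  assumes "m \<in> klines" obtains e where "e \<in> klines" "klein e m = 0" "m \<notin> span {e}"
proof -
  obtain x y where m: "m = pluecker x y" "pluecker x y \<noteq> 0" using assms by (rule klinesE)
  obtain f g where D: "klein (pluecker x y) (pluecker f g) \<noteq> 0"
    using klein_pluecker_nondegenerate[OF m(2)] .
  show thesis
  proof
    have "klein (pluecker x f) (pluecker y g) \<noteq> 0" using D klein_pluecker_swap[of x f y g] by simp
    then show "pluecker x f \<in> klines" by (rule pluecker_in_klines)
    show "klein (pluecker x f) m = 0" by (simp add: m)
    show "m \<notin> span {pluecker x f}"
      using D by (intro not_in_span_klein[of _ "pluecker f g"]) (auto simp: m)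
  qed
qed

section \<open>Ways of adding lines to a good configuration\<close>

text \<open>All new lines pass through one generic point.\<close>

lemma good_star:
  assumes L: "good L" and fin: "finite L"
  obtains f where "\<And>m l. m \<in> L \<Longrightarrow> l \<in> L \<Longrightarrow> klein (f m) l = 0 \<longleftrightarrow> l = m"
    "\<And>m m'. m \<in> L \<Longrightarrow> m' \<in> L \<Longrightarrow> klein (f m) (f m') = 0"
    "f ` L \<inter> L = {}" "good (L \<union> f ` L)"
proof -
  have "\<exists>q. m = pluecker (fst q) (snd q)" if "m \<in> L" for m
    using goodD(1)[OF L that] by (metis fst_conv klinesE snd_conv)
  then obtain q where q: "\<And>m. m \<in> L \<Longrightarrow> m = pluecker (fst (q m)) (snd (q m))" by metis
  define w where "w m s r = pluecker (moment s) (fst (q m) + r *\<^sub>R snd (q m))" for m s r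
  have star: "\<forall>\<^sub>F s in cofinite. \<forall>\<^sub>F r in cofinite. klein (w m s r) e \<noteq> 0"
    if "m \<in> L" "e \<in> klines" "m \<notin> span {e}" for m e
    using star_cofinite[of e "fst (q m)" "snd (q m)"] q[OF that(1)] that unfolding w_def by simp
  define Q where "Q m w \<longleftrightarrow> (\<forall>l\<in>L - {m}. klein w l \<noteq> 0) \<and> (\<forall>(x, y, z)\<in>triples L. w \<notin> span {x, y, z}) \<and>
    w \<notin> span {m} \<and> w \<in> klines" for m w
  have "\<forall>\<^sub>F s in cofinite. \<forall>\<^sub>F r in cofinite. Q m (w m s r)" if m: "m \<in> L" for m
    unfolding Q_def
  proof (intro eventually_eventually_conj eventually_eventually_ball)
    show "finite (L - {m})" "finite (triples L)" using fin finite_triples by auto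
  next
    fix l assume "l \<in> L - {m}"
    then show "\<forall>\<^sub>F s in cofinite. \<forall>\<^sub>F r in cofinite. klein (w m s r) l \<noteq> 0"
      using goodD[OF L] m by (intro star) auto
  next
    fix u assume "u \<in> triples L"
    then obtain x y z where u: "u = (x, y, z)" "x \<in> L" "y \<in> L" "z \<in> L" "skew x y z"
      by (auto simp: triples_def)
    obtain t where t: "t \<in> klines" "\<And>u. u \<in> {x, y, z} \<Longrightarrow> klein t u = 0" "m \<notin> span {t}"
      using transversal_avoiding[of x y z m m] u m goodD(1)[OF L] by metis
    have "\<forall>\<^sub>F s in cofinite. \<forall>\<^sub>F r in cofinite. w m s r \<notin> span {x, y, z}"
      using star[OF m t(1,3)] by (rule eventually_eventually_mono) (use t(2) not_in_span_klein in blast)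
    then show "\<forall>\<^sub>F s in cofinite. \<forall>\<^sub>F r in cofinite. case u of (x, y, z) \<Rightarrow> w m s r \<notin> span {x, y, z}"
      by (simp add: u)
  next
    obtain e where e: "e \<in> klines" "klein e m = 0" "m \<notin> span {e}"
      using line_meeting goodD(1)[OF L m] by blast
    show "\<forall>\<^sub>F s in cofinite. \<forall>\<^sub>F r in cofinite. w m s r \<notin> span {m}"
      using star[OF m e(1,3)] by (rule eventually_eventually_mono) (use e(2) not_in_span_klein[of _ e "{m}"] in auto)
    show "\<forall>\<^sub>F s in cofinite. \<forall>\<^sub>F r in cofinite. w m s r \<in> klines"
      using star[OF m e(1,3)] by (rule eventually_eventually_mono) (auto simp: w_def intro: pluecker_in_klines)
  qed
  then have "\<forall>\<^sub>F s in cofinite. \<forall>m\<in>L. \<forall>\<^sub>F r in cofinite. Q m (w m s r)"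
    using fin by (intro eventually_ball_finite) auto
  \<comment> \<open>One \<open>s\<close> serves all \<open>m\<close>, so the new lines share the
    point \<open>moment s\<close>; only then is \<open>r\<close> chosen for each
    \<open>m\<close>.\<close>
  then obtain s where "\<forall>m\<in>L. \<forall>\<^sub>F r in cofinite. Q m (w m s r)" using cofinite_ex by blast
  then have "\<forall>m\<in>L. \<exists>r. Q m (w m s r)" using cofinite_ex by blast
  then obtain r where r: "\<And>m. m \<in> L \<Longrightarrow> Q m (w m s (r m))" by metis
  define f where "f m = w m s (r m)" for m
  have f: "m \<in> L \<Longrightarrow> l \<in> L \<Longrightarrow> l \<noteq> m \<Longrightarrow> klein (f m) l \<noteq> 0" "m \<in> L \<Longrightarrow> f m \<notin> span {m}" "m \<in> L \<Longrightarrow> f m \<in> klines"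
    "m \<in> L \<Longrightarrow> x \<in> L \<Longrightarrow> y \<in> L \<Longrightarrow> z \<in> L \<Longrightarrow> skew x y z \<Longrightarrow> f m \<notin> span {x, y, z}" for m l x y z
    using r unfolding Q_def f_def triples_def by blast+
  have mm: "klein (f m) m = 0" if "m \<in> L" for m
  proof -
    have "klein (f m) (pluecker (fst (q m)) (snd (q m))) = 0"
      unfolding f_def w_def by (rule klein_through) (auto intro: span_add span_scale span_base)
    then show ?thesis using q[OF that] by simp
  qed
  have lm: "klein (f m) l = 0 \<longleftrightarrow> l = m" if "m \<in> L" "l \<in> L" for l m
  proof
    assume "klein (f m) l = 0"
    then show "l = m" using f that by blast
  qed (use mm that in simp)
  have ff: "klein (f m) (f m') = 0" for m m'
    by (simp add: f_def w_def)
  show thesis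
  proof
    \<comment> \<open>A line meets itself, and \<open>m\<close> is the only old line that
      \<open>f m\<close> meets.\<close>
    have "f m \<notin> L" if "m \<in> L" for m
    proof
      assume "f m \<in> L"
      then have "f m = m" using lm[OF that] ff by blast
      then show False using f(2)[OF that] span_base[of m "{m}"] by simp
    qed
    then show "f ` L \<inter> L = {}" by blast
    show "good (L \<union> f ` L)"
    proof (rule good_Un[OF L])
      show "f ` L \<subseteq> klines" using f by blast
    next
      fix w w' assume "w \<in> f ` L" "w' \<in> f ` L" "w \<noteq> w'"
      then obtain m m' where "w = f m" "w' = f m'" "m \<in> L" "m' \<in> L" "m \<noteq> m'" by blast
      \<comment> \<open>The line \<open>m\<close> meets \<open>f m\<close> but not
        \<open>f m'\<close>.\<close>
      then show "w' \<notin> span {w}"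
        using lm[of m' m] mm[of m] by (intro not_in_span_klein[of _ m]) (auto simp: klein_commute[of m])
    next
      fix w l assume "w \<in> f ` L" "l \<in> L"
      then obtain m where m: "w = f m" "m \<in> L" by blast
      show "w \<notin> span {l}"
      proof (cases "l = m")
        case True then show ?thesis using f m by simp
      next
        case False then show ?thesis
          using f m \<open>l \<in> L\<close> goodD(1)[OF L] by (intro not_in_span_klein_self) auto
      qed
    next
      fix w x y z assume "w \<in> f ` L" "x \<in> L" "y \<in> L" "z \<in> L" "skew x y z"
      then show "w \<notin> span {x, y, z}" using f(4) by blast
    qed (use ff in auto)
  qed (use lm ff in auto)
qed

text \<open>Both new lines join one generic point of \<open>d\<close> to a point of \<open>c\<close>.\<close>

lemma good_pair:
  assumes L: "good L" and fin: "finite L" and cd: "c \<in> L" "d \<in> L" "klein d c \<noteq> 0"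
  obtains a b where "a \<noteq> b" "klein a b = 0" "good (L \<union> {a, b})"
    "\<And>w l. w \<in> {a, b} \<Longrightarrow> l \<in> L \<Longrightarrow> klein w l = 0 \<longleftrightarrow> l \<in> {c, d}"
proof -
  have K: "l \<in> L \<Longrightarrow> l \<in> klines" for l using goodD(1)[OF L] .
  obtain c1 c2 where c: "c = pluecker c1 c2" using K[OF cd(1)] by (rule klinesE)
  obtain d1 d2 where d: "d = pluecker d1 d2" using K[OF cd(2)] by (rule klinesE)
  define w where "w s r = pluecker (d1 + s *\<^sub>R d2) (c1 + r *\<^sub>R c2)" for s r
  have pair: "\<forall>\<^sub>F s in cofinite. \<forall>\<^sub>F r in cofinite. klein (w s r) e \<noteq> 0"
    if "e \<in> klines" "c \<notin> span {e}" "d \<notin> span {e}" for e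
    unfolding w_def
  proof (rule pair_cofinite)
    show "e \<notin> span {pluecker d1 d2}" "e \<notin> span {pluecker c1 c2}"
      using that in_span_singleton_sym[of e] klines_nonzero[OF that(1)] unfolding c d by blast+
  qed (use cd that in \<open>auto simp: c d\<close>)
  define Q where "Q w \<longleftrightarrow> (\<forall>l\<in>L - {c, d}. klein w l \<noteq> 0) \<and> (\<forall>(x, y, z)\<in>triples L. w \<notin> span {x, y, z})" for w
  have "\<forall>\<^sub>F s in cofinite. \<forall>\<^sub>F r in cofinite. Q (w s r)"
    unfolding Q_def
  proof (intro eventually_eventually_conj eventually_eventually_ball)
    show "finite (L - {c, d})" "finite (triples L)" using fin finite_triples by auto
  next
    fix l assume "l \<in> L - {c, d}"
    then show "\<forall>\<^sub>F s in cofinite. \<forall>\<^sub>F r in cofinite. klein (w s r) l \<noteq> 0"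
      using goodD[OF L] cd by (intro pair) auto
  next
    fix u assume "u \<in> triples L"
    then obtain x y z where u: "u = (x, y, z)" "x \<in> L" "y \<in> L" "z \<in> L" "skew x y z"
      by (auto simp: triples_def)
    obtain t where t: "t \<in> klines" "\<And>u. u \<in> {x, y, z} \<Longrightarrow> klein t u = 0" "c \<notin> span {t}" "d \<notin> span {t}"
      using transversal_avoiding[of x y z c d] u cd K by metis
    have "\<forall>\<^sub>F s in cofinite. \<forall>\<^sub>F r in cofinite. w s r \<notin> span {x, y, z}"
      using pair[OF t(1,3,4)] by (rule eventually_eventually_mono) (use t(2) not_in_span_klein in blast)
    then show "\<forall>\<^sub>F s in cofinite. \<forall>\<^sub>F r in cofinite. case u of (x, y, z) \<Rightarrow> w s r \<notin> span {x, y, z}"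
      by (simp add: u)
  qed
  then obtain s where s: "\<forall>\<^sub>F r in cofinite. Q (w s r)" by (rule cofinite_ex)
  then obtain r1 where r1: "Q (w s r1)" by (rule cofinite_ex)
  have "\<forall>\<^sub>F r in cofinite. Q (w s r) \<and> r \<noteq> r1"
    using s by (intro eventually_conj) (auto simp: eventually_cofinite)
  \<comment> \<open>The same \<open>s\<close> with another \<open>r\<close> gives a second line
    through the same point of \<open>d\<close>, ending at a different point of
    \<open>c\<close>.\<close>
  then obtain r2 where "Q (w s r2) \<and> r2 \<noteq> r1" by (rule cofinite_ex)
  then have r2: "Q (w s r2)" "r2 \<noteq> r1" by auto
  have wc: "klein (w s r) c = 0" for r
    unfolding w_def c by (rule klein_through) (auto intro: span_add span_scale span_base)
  have wd: "klein (w s r) d = 0" for r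
    unfolding w_def d by (rule klein_through) (auto intro: span_add span_scale span_base)
  \<comment> \<open>The test line joins \<open>d2\<close> to the point of \<open>c\<close> with
    parameter \<open>t\<close>; it meets the new line with parameter \<open>r\<close> only if
    \<open>r = t\<close>. This separates the new lines from each other and shows that they are
    nonzero.\<close>
  have cross: "klein (w s r) (pluecker d2 (c1 + t *\<^sub>R c2)) = (r - t) * klein d c" for r t
  proof -
    have "klein (w s r) (pluecker d2 (c1 + t *\<^sub>R c2)) =
        klein (pluecker d1 (c1 + r *\<^sub>R c2)) (pluecker d2 (c1 + t *\<^sub>R c2))"
      by (simp add: w_def pluecker_add_left pluecker_scaleR_left klein_add_left klein_scaleR_left)
    also have "\<dots> = - klein d (pluecker (c1 + r *\<^sub>R c2) (c1 + t *\<^sub>R c2))"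
      unfolding d by (rule klein_pluecker_swap)
    also have "pluecker (c1 + r *\<^sub>R c2) (c1 + t *\<^sub>R c2) = (t - r) *\<^sub>R c"
      by (simp add: c pluecker_linear pluecker_swap[of c2 c1] algebra_simps)
    finally show ?thesis by (simp only: klein_scaleR_right) (simp add: left_diff_distrib)
  qed
  have wk: "w s r \<in> klines" for r
  proof -
    have "klein (w s r) (pluecker d2 (c1 + (r + 1) *\<^sub>R c2)) \<noteq> 0" using cross cd(3) by simp
    then show ?thesis unfolding w_def by (rule pluecker_in_klines)
  qed
  have wl: "klein (w s r) l = 0 \<longleftrightarrow> l \<in> {c, d}" if "r \<in> {r1, r2}" "l \<in> L" for r l
    using r1 r2(1) that wc wd unfolding Q_def by blast
  have tr: "w s r \<notin> span {x, y, z}" if "r \<in> {r1, r2}" "x \<in> L" "y \<in> L" "z \<in> L" "skew x y z" for r x y z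
    using r1 r2(1) that unfolding Q_def triples_def by blast
  have ns: "w s r \<notin> span {w s t}" if "r \<noteq> t" for r t
    using cross[of t t] cross[of r t] that cd(3)
    by (intro not_in_span_klein[of _ "pluecker d2 (c1 + t *\<^sub>R c2)"]) (auto simp: klein_commute)
  show thesis
  proof
    show "w s r1 \<noteq> w s r2" using ns[OF r2(2)] span_base[of "w s r2" "{w s r2}"] by auto
    show "klein (w s r1) (w s r2) = 0" by (simp add: w_def)
    show "good (L \<union> {w s r1, w s r2})"
    proof (rule good_Un[OF L])
      fix v l assume v: "v \<in> {w s r1, w s r2}" "l \<in> L"
      then obtain r where r: "v = w s r" "r \<in> {r1, r2}" by blast
      show "v \<notin> span {l}"
      proof (cases "l \<in> {c, d}")
        case True
        \<comment> \<open>If \<open>l\<close> is one of the skew lines \<open>c, d\<close>, the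
          other one meets \<open>v\<close> but not \<open>l\<close>.\<close>
        have "klein c d \<noteq> 0" using cd(3) klein_commute[of c d] by simp
        then have "\<exists>m. klein v m = 0 \<and> klein l m \<noteq> 0"
          using True cd(3) wc[of r] wd[of r] r(1) by blast
        then obtain m where "klein v m = 0" "klein l m \<noteq> 0" by blast
        moreover have "v \<noteq> 0" using klines_nonzero[OF wk] r by simp
        ultimately show ?thesis
          by (auto simp: span_singleton klein_linear)
      next
        case False
        then show ?thesis using r wl v K wk by (intro not_in_span_klein_self) auto
      qed
    next
      fix v x y z assume "v \<in> {w s r1, w s r2}" "x \<in> L" "y \<in> L" "z \<in> L" "skew x y z"
      then show "v \<notin> span {x, y, z}" using tr by blast
    next
      fix v v' assume "v \<in> {w s r1, w s r2}" "v' \<in> {w s r1, w s r2}"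
      then show "klein v v' = 0" by (auto simp: w_def)
    next
      fix v v' assume "v \<in> {w s r1, w s r2}" "v' \<in> {w s r1, w s r2}" "v \<noteq> v'"
      then obtain r t where "v = w s r" "v' = w s t" "t \<noteq> r" by blast
      then show "v' \<notin> span {v}" using ns by simp
    qed (use wk in auto)
  next
    fix v l assume "v \<in> {w s r1, w s r2}" "l \<in> L"
    then show "klein v l = 0 \<longleftrightarrow> l \<in> {c, d}" using wl[of r1 l] wl[of r2 l] by blast
  qed
qed

text \<open>The last hypothesis rules out that every line meeting \<open>a, b, c\<close> lies in the regulus of three old
  lines \<open>x, y, z\<close>.\<close>

lemma good_regulus:
  assumes L: "good L" and fin: "finite L" and abc: "a \<in> L" "b \<in> L" "c \<in> L" "skew a b c"
    and no: "\<And>x y z. x \<in> L \<Longrightarrow> y \<in> L \<Longrightarrow> z \<in> L \<Longrightarrow> skew x y z \<Longrightarrow>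
      klein x a = 0 \<Longrightarrow> klein y a = 0 \<Longrightarrow> klein z a = 0 \<Longrightarrow> False"
  obtains w where "good (insert w L)" "\<And>l. l \<in> L \<Longrightarrow> klein w l = 0 \<longleftrightarrow> l \<in> {a, b, c}"
proof -
  have K: "l \<in> L \<Longrightarrow> l \<in> klines" for l using goodD(1)[OF L] .
  have sk: "klein a b \<noteq> 0" "klein a c \<noteq> 0" "klein b c \<noteq> 0" "klein b a \<noteq> 0" "klein c a \<noteq> 0" "klein c b \<noteq> 0"
    using abc(4) by (auto simp: skew_def klein_commute)
  obtain v where v: "\<And>s. klein (v s) a = 0" "\<And>s. klein (v s) b = 0" "\<And>s. klein (v s) c = 0"
    "\<And>s. \<exists>x y. v s = pluecker x y"
    and g: "\<And>e. e \<notin> span {a, b, c} \<Longrightarrow> \<forall>\<^sub>F s::real in cofinite. klein (v s) e \<noteq> 0"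
    using regulus_cofinite[of a b c] abc K by blast
  \<comment> \<open>An old line in the span of \<open>a, b, c\<close> that is skew to all three is
    excluded by goodness. If it meets one of them, isotropy forces it to be a multiple of that
    one.\<close>
  have out: "l \<notin> span {a, b, c}" if l: "l \<in> L" "l \<notin> {a, b, c}" for l
  proof
    assume "l \<in> span {a, b, c}"
    then obtain i j k where l_eq: "l = i *\<^sub>R a + j *\<^sub>R b + k *\<^sub>R c" by (auto simp: in_span_3)
    define p q r where "p = klein a b" and "q = klein a c" and "r = klein b c"
    have pqr: "p \<noteq> 0" "q \<noteq> 0" "r \<noteq> 0" using sk by (auto simp: p_def q_def r_def)
    have s: "klein a a = 0" "klein b b = 0" "klein c c = 0" "klein l l = 0" using abc K l by auto
    have e: "klein l a = j * p + k * q" "klein l b = i * p + k * r" "klein l c = i * q + j * r"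
      unfolding l_eq using s(1-3)
      by (simp_all add: klein_linear klein_commute[of b a] klein_commute[of c a] klein_commute[of c b] p_def q_def r_def)
    have "klein l l = i * klein l a + j * klein l b + k * klein l c"
      by (metis l_eq klein_add_right klein_scaleR_right)
    \<comment> \<open>This is half of \<open>klein l l\<close>.\<close>
    then have z: "i * j * p + i * k * q + j * k * r = 0" using s(4) e by (simp add: algebra_simps)
    consider "klein l a \<noteq> 0" "klein l b \<noteq> 0" "klein l c \<noteq> 0" | "klein l a = 0" | "klein l b = 0" | "klein l c = 0"
      by blast
    then have "\<exists>m\<in>{a, b, c}. l \<in> span {m}"
    proof cases
      case 1
      then show ?thesis using goodD(3)[OF L abc(1-3) l(1) abc(4)] \<open>l \<in> span {a, b, c}\<close> by blast
    next
      case 2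
      then have 0: "j * p + k * q = 0" using e by simp
      have "j * k * r = (i * j * p + i * k * q + j * k * r) - i * (j * p + k * q)"
        by (simp add: algebra_simps)
      then have "j * k * r = 0" using z 0 by simp
      then have "j = 0 \<and> k = 0" using 0 pqr by auto
      then show ?thesis unfolding l_eq by (auto simp: span_singleton)
    next
      case 3
      then have 0: "i * p + k * r = 0" using e by simp
      have "i * k * q = (i * j * p + i * k * q + j * k * r) - j * (i * p + k * r)"
        by (simp add: algebra_simps)
      then have "i * k * q = 0" using z 0 by simp
      then have "i = 0 \<and> k = 0" using 0 pqr by auto
      then show ?thesis unfolding l_eq by (auto simp: span_singleton)
    next
      case 4
      then have 0: "i * q + j * r = 0" using e by simp
      have "i * j * p = (i * j * p + i * k * q + j * k * r) - k * (i * q + j * r)"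
        by (simp add: algebra_simps)
      then have "i * j * p = 0" using z 0 by simp
      then have "i = 0 \<and> j = 0" using 0 pqr by auto
      then show ?thesis unfolding l_eq by (auto simp: span_singleton)
    qed
    then show False using goodD(2)[OF L] abc l by blast
  qed
  \<comment> \<open>If three skew transversals of \<open>x, y, z\<close> all lay in the span of
    \<open>a, b, c\<close>, they would span it by dimension. Then \<open>a\<close> would be
    orthogonal to \<open>x, y, z\<close>, which \<open>no\<close> forbids.\<close>
  have tr: "\<exists>t. t \<notin> span {a, b, c} \<and> (\<forall>u\<in>{x, y, z}. klein t u = 0)"
    if u: "x \<in> L" "y \<in> L" "z \<in> L" "skew x y z" for x y z
  proof -
    obtain t1 t2 t3 where t: "{t1, t2, t3} \<subseteq> klines" "skew t1 t2 t3"
      "\<And>t x'. t \<in> {t1, t2, t3} \<Longrightarrow> x' \<in> {x, y, z} \<Longrightarrow> klein t x' = 0"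
      using transversals[of x y z] u K by metis
    have "\<not> {t1, t2, t3} \<subseteq> span {a, b, c}"
    proof
      assume sub: "{t1, t2, t3} \<subseteq> span {a, b, c}"
      have "dim {t1, t2, t3} = 3" "dim {a, b, c} = 3"
        using skew_dim t abc K by auto
      then have "span {t1, t2, t3} = span {a, b, c}"
        using sub by (intro subspace_dim_equal span_minimal) auto
      then have "a \<in> span {t1, t2, t3}" by (simp add: span_base)
      then have "klein x' a = 0" if "x' \<in> {x, y, z}" for x'
        using that t(3) klein_span_eq_0[of a "{t1, t2, t3}" x'] klein_commute by metis
      then show False using no u by blast
    qed
    then show ?thesis using t(3) by blast
  qed
  have "\<forall>\<^sub>F s in cofinite. (\<forall>l\<in>L - {a, b, c}. klein (v s) l \<noteq> 0) \<and>
      (\<forall>(x, y, z)\<in>triples L. v s \<notin> span {x, y, z}) \<and> v s \<noteq> 0"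
  proof (intro eventually_conj eventually_ball_finite ballI)
    show "finite (L - {a, b, c})" "finite (triples L)" using fin finite_triples by auto
  next
    fix l assume "l \<in> L - {a, b, c}"
    then show "\<forall>\<^sub>F s in cofinite. klein (v s) l \<noteq> 0" using g out by blast
  next
    fix u assume "u \<in> triples L"
    then obtain x y z where u: "u = (x, y, z)" "x \<in> L" "y \<in> L" "z \<in> L" "skew x y z"
      by (auto simp: triples_def)
    obtain t where t: "t \<notin> span {a, b, c}" "\<And>u. u \<in> {x, y, z} \<Longrightarrow> klein t u = 0"
      using tr[OF u(2-5)] by metis
    have "\<forall>\<^sub>F s in cofinite. v s \<notin> span {x, y, z}"
      using g[OF t(1)] by (rule eventually_mono) (use t(2) not_in_span_klein in blast)
    then show "\<forall>\<^sub>F s in cofinite. case u of (x, y, z) \<Rightarrow> v s \<notin> span {x, y, z}"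
      by (simp add: u)
  next
    obtain e where "e \<notin> span {a, b, c}" using tr[OF abc] by metis
    from g[OF this] show "\<forall>\<^sub>F s in cofinite. v s \<noteq> 0"
      by (rule eventually_mono) auto
  qed
  then obtain s where "(\<forall>l\<in>L - {a, b, c}. klein (v s) l \<noteq> 0) \<and>
      (\<forall>(x, y, z)\<in>triples L. v s \<notin> span {x, y, z}) \<and> v s \<noteq> 0"
    by (rule cofinite_ex)
  then have s: "\<And>l. l \<in> L \<Longrightarrow> l \<notin> {a, b, c} \<Longrightarrow> klein (v s) l \<noteq> 0"
    "\<And>x y z. (x, y, z) \<in> triples L \<Longrightarrow> v s \<notin> span {x, y, z}" "v s \<noteq> 0"
    by blast+
  have vk: "v s \<in> klines" using v(4)[of s] s(3) unfolding klines_def by (metis (mono_tags, lifting) mem_Collect_eq)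
  show thesis
  proof
    show "good (insert (v s) L)"
    proof (rule good_insert[OF L vk])
      fix l assume l: "l \<in> L"
      show "v s \<notin> span {l}"
      proof (cases "l \<in> {a, b, c}")
        case True
        then obtain m where "klein (v s) m = 0" "klein l m \<noteq> 0" using v sk by blast
        then show ?thesis using s(3) by (auto simp: span_singleton klein_linear)
      next
        case False
        then show ?thesis using s vk K l by (intro not_in_span_klein_self) auto
      qed
    next
      fix x y z assume "x \<in> L" "y \<in> L" "z \<in> L" "skew x y z"
      then show "v s \<notin> span {x, y, z}" using s(2) unfolding triples_def by blast
    qed
  next
    fix l assume "l \<in> L" then show "klein (v s) l = 0 \<longleftrightarrow> l \<in> {a, b, c}" using s v by blast
  qed
qed

text \<open>The curve of Pluecker vectors lies in no hyperplane, so a generic member is skew to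
  every old line and avoids all their reguli.\<close>

lemma good_isolated:
  assumes L: "good L" and fin: "finite L"
  obtains w where "good (insert w L)" "\<And>l. l \<in> L \<Longrightarrow> klein w l \<noteq> 0"
proof -
  have K: "l \<in> L \<Longrightarrow> l \<in> klines" for l using goodD(1)[OF L] .
  have "\<forall>\<^sub>F s in cofinite. (\<forall>l\<in>L. klein (curve s) l \<noteq> 0) \<and>
      (\<forall>(x, y, z)\<in>triples L. curve s \<notin> span {x, y, z}) \<and> curve s \<noteq> 0"
  proof (intro eventually_conj eventually_ball_finite ballI)
    show "finite L" "finite (triples L)" using fin finite_triples by auto
  next
    fix l assume "l \<in> L"
    then show "\<forall>\<^sub>F s in cofinite. klein (curve s) l \<noteq> 0" using K klines_nonzero curve_cofinite by blast
  next
    fix u assume "u \<in> triples L"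
    then obtain x y z where u: "u = (x, y, z)" "x \<in> L" "y \<in> L" "z \<in> L" "skew x y z"
      by (auto simp: triples_def)
    obtain t where t: "t \<in> klines" "\<And>u. u \<in> {x, y, z} \<Longrightarrow> klein t u = 0"
      using transversal_avoiding[of x y z x x] u K by metis
    have "\<forall>\<^sub>F s in cofinite. curve s \<notin> span {x, y, z}"
      using curve_cofinite[OF klines_nonzero[OF t(1)]] by (rule eventually_mono) (use t(2) not_in_span_klein in blast)
    then show "\<forall>\<^sub>F s in cofinite. case u of (x, y, z) \<Rightarrow> curve s \<notin> span {x, y, z}"
      by (simp add: u)
  next
    show "\<forall>\<^sub>F s in cofinite. curve s \<noteq> 0"
      using curve_cofinite[of "(1, 1, 1, 1, 1, 1)"] by (rule eventually_mono) (auto simp: zero_prod_def)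
  qed
  then obtain s where "(\<forall>l\<in>L. klein (curve s) l \<noteq> 0) \<and>
      (\<forall>(x, y, z)\<in>triples L. curve s \<notin> span {x, y, z}) \<and> curve s \<noteq> 0"
    by (rule cofinite_ex)
  then have s: "\<And>l. l \<in> L \<Longrightarrow> klein (curve s) l \<noteq> 0"
    "\<And>x y z. (x, y, z) \<in> triples L \<Longrightarrow> curve s \<notin> span {x, y, z}" "curve s \<noteq> 0"
    by blast+
  have ck: "curve s \<in> klines" using s(3) unfolding curve_def klines_def by blast
  show thesis
  proof
    show "good (insert (curve s) L)"
    proof (rule good_insert[OF L ck])
      fix l assume "l \<in> L"
      then show "curve s \<notin> span {l}" using s ck K by (intro not_in_span_klein_self) auto
    next
      fix x y z assume "x \<in> L" "y \<in> L" "z \<in> L" "skew x y z"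
      then show "curve s \<notin> span {x, y, z}" using s(2) unfolding triples_def by blast
    qed
  qed (use s in auto)
qed

text \<open>Supplies the dummy lines that stand in for missing neighbours.\<close>

lemma good_isolated_set:
  assumes L: "good L" and fin: "finite L"
  obtains D where "finite D" "card D = n" "D \<inter> L = {}" "good (L \<union> D)"
    "\<And>d l. d \<in> D \<Longrightarrow> l \<in> L \<union> D \<Longrightarrow> l \<noteq> d \<Longrightarrow> klein d l \<noteq> 0"
proof -
  have "\<exists>D. finite D \<and> card D = n \<and> D \<inter> L = {} \<and> good (L \<union> D) \<and>
    (\<forall>d\<in>D. \<forall>l\<in>L \<union> D. l \<noteq> d \<longrightarrow> klein d l \<noteq> 0)"
  proof (induction n)
    case 0
    then show ?case using L by (intro exI[of _ "{}"]) auto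
  next
    case (Suc n)
    then obtain D where D: "finite D" "card D = n" "D \<inter> L = {}" "good (L \<union> D)"
      "\<And>d l. d \<in> D \<Longrightarrow> l \<in> L \<union> D \<Longrightarrow> l \<noteq> d \<Longrightarrow> klein d l \<noteq> 0" by blast
    obtain w where w: "good (insert w (L \<union> D))" "\<And>l. l \<in> L \<union> D \<Longrightarrow> klein w l \<noteq> 0"
      using good_isolated[OF D(4)] fin D(1) by blast
    have "klein w w = 0" using goodD(1)[OF w(1)] by simp
    then have "w \<notin> L \<union> D" using w(2) by blast
    moreover have "klein d w \<noteq> 0" if "d \<in> D" for d using w(2)[of d] that by (simp add: klein_commute)
    ultimately have "\<forall>d\<in>insert w D. \<forall>l\<in>L \<union> insert w D. l \<noteq> d \<longrightarrow> klein d l \<noteq> 0"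
      using D(5) w(2) by blast
    then show ?case using D(1-3) w(1) \<open>w \<notin> L \<union> D\<close>
      by (intro exI[of _ "insert w D"]) simp
  qed
  then show thesis using that by blast
qed

text \<open>Dummies complete \<open>S\<close> to three skew lines, and a generic transversal of
  these is the new line. The degree bound yields the last hypothesis of
  \<open>good_regulus\<close>.\<close>

lemma good_attach:
  assumes L: "good L" and fin: "finite L" and S: "S \<subseteq> L" "card S \<le> 3"
    "\<And>x y. x \<in> S \<Longrightarrow> y \<in> S \<Longrightarrow> x \<noteq> y \<Longrightarrow> klein x y \<noteq> 0"
    and deg: "\<And>a. a \<in> S \<Longrightarrow> card {x \<in> L. x \<noteq> a \<and> klein x a = 0} \<le> 2"
  obtains w where "good (insert w L)" "w \<notin> L" "\<And>l. l \<in> L \<Longrightarrow> klein w l = 0 \<longleftrightarrow> l \<in> S"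
proof -
  obtain D where D: "finite D" "card D = 3 - card S" "D \<inter> L = {}" "good (L \<union> D)"
    "\<And>d l. d \<in> D \<Longrightarrow> l \<in> L \<union> D \<Longrightarrow> l \<noteq> d \<Longrightarrow> klein d l \<noteq> 0"
    using good_isolated_set[OF L fin] by metis
  have K: "l \<in> L \<union> D \<Longrightarrow> l \<in> klines" for l using goodD(1)[OF D(4)] .
  have D': "klein l d \<noteq> 0" if "d \<in> D" "l \<in> L \<union> D" "l \<noteq> d" for d l
    using D(5)[OF that] klein_commute by metis
  have "finite S" using S fin finite_subset by blast
  then have "card (S \<union> D) = 3" using S D by (subst card_Un_disjoint) auto
  then obtain a b c where abc: "S \<union> D = {a, b, c}" "a \<noteq> b" "b \<noteq> c" "a \<noteq> c"
    by (metis card_3_iff)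
  have pw: "klein x y \<noteq> 0" if "x \<in> S \<union> D" "y \<in> S \<union> D" "x \<noteq> y" for x y
    using that S D(5) D' by blast
  have sk: "skew a b c" unfolding skew_def using pw abc by auto
  have mem: "a \<in> L \<union> D" "b \<in> L \<union> D" "c \<in> L \<union> D" using abc S by auto
  \<comment> \<open>Dummies meet no other line, so \<open>a\<close> is in \<open>S\<close> and
    \<open>x, y, z\<close> would be three distinct lines of \<open>L\<close> meeting it.\<close>
  have no: False if x: "x \<in> L \<union> D" "y \<in> L \<union> D" "z \<in> L \<union> D" "skew x y z"
    "klein x a = 0" "klein y a = 0" "klein z a = 0" for x y z
  proof -
    have "x \<noteq> a" "y \<noteq> a" "z \<noteq> a"
      using x(4-7) unfolding skew_def by (metis klein_commute)+
    moreover have "x \<noteq> y" "y \<noteq> z" "x \<noteq> z" 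
      using x(4) K[OF x(1)] K[OF x(2)] K[OF x(3)] klein_klines_self unfolding skew_def by metis+
    moreover have "a \<notin> D" using D'[OF _ x(1)] x(5) \<open>x \<noteq> a\<close> by metis
    moreover have "x \<notin> D" "y \<notin> D" "z \<notin> D"
      using x(5-7) D(5)[OF _ mem(1)] \<open>x \<noteq> a\<close> \<open>y \<noteq> a\<close> \<open>z \<noteq> a\<close> by metis+
    ultimately have aS: "a \<in> S" and "{x, y, z} \<subseteq> {x \<in> L. x \<noteq> a \<and> klein x a = 0}"
      using abc x by blast+
    then have "card {x, y, z} \<le> card {x \<in> L. x \<noteq> a \<and> klein x a = 0}"
      using fin by (intro card_mono) auto
    then show False using deg[OF aS] \<open>x \<noteq> y\<close> \<open>y \<noteq> z\<close> \<open>x \<noteq> z\<close> by simp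
  qed
  obtain w where w: "good (insert w (L \<union> D))" "\<And>l. l \<in> L \<union> D \<Longrightarrow> klein w l = 0 \<longleftrightarrow> l \<in> {a, b, c}"
    by (rule good_regulus[OF D(4) _ mem sk]) (use fin D(1) no in blast)+
  show thesis
  proof
    \<comment> \<open>The dummies are discarded.\<close>
    show "good (insert w L)" using w(1) by (rule good_subset) auto
    show "klein w l = 0 \<longleftrightarrow> l \<in> S" if "l \<in> L" for l
      using w(2)[of l] that abc(1) D(3) by blast
    have "klein w w = 0" using goodD(1)[OF w(1)] by simp
    \<comment> \<open>An old \<open>w\<close>, meeting itself, would be one of
      \<open>a, b, c\<close>; but it meets all three, and these are skew.\<close>
    show "w \<notin> L"
    proof
      assume "w \<in> L"
      then have "w \<in> {a, b, c}" using w(2) \<open>klein w w = 0\<close> by blast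
      then have "klein a w \<noteq> 0 \<or> klein b w \<noteq> 0 \<or> klein c w \<noteq> 0"
        using sk unfolding skew_def by (metis insertE singletonD klein_commute)
      moreover have "klein a w = 0" "klein b w = 0" "klein c w = 0"
        using w(2) mem by (auto simp: klein_commute)
      ultimately show False by blast
    qed
  qed
qed

section \<open>Lines of projective space\<close>

text \<open>For a line this is its two-dimensional subspace of \<real>^4, described without choosing
  spanning vectors.\<close>

definition kspace :: "pvec \<Rightarrow> (real^4) set" where
  "kspace k = {v. \<forall>u. klein (pluecker v u) k = 0}"

definition kline :: "pvec \<Rightarrow> (real^4) set set" where
  "kline k = {p \<in> proj_points. p \<subseteq> kspace k}"

lemma kspace_pluecker:
  assumes "pluecker x y \<noteq> 0" shows "kspace (pluecker x y) = span {x, y}"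
proof (intro subset_antisym subsetI)
  fix v assume "v \<in> kspace (pluecker x y)"
  then show "v \<in> span {x, y}"
    by (intro point_on_line[OF assms]) (simp add: kspace_def klein_commute[of "pluecker x y"])
qed (simp add: kspace_def klein_through)

lemma pluecker_nonzero_dim: "pluecker x y \<noteq> 0 \<Longrightarrow> dim (span {x, y}) = 2"
proof -
  assume nz: "pluecker x y \<noteq> 0"
  then have "x \<noteq> y" "y \<noteq> 0" "x \<notin> span {y}"
    by (auto simp: span_singleton pluecker_scaleR_left) (simp add: pluecker_def zero_prod_def)
  then have "independent {x, y}" by (simp add: independent_insert)
  then show ?thesis using \<open>x \<noteq> y\<close> by (simp add: dim_eq_card_independent)
qed

lemma proj_line_kline:
  assumes "k \<in> klines" shows "proj_line (kline k)"
proof -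
  obtain x y where "k = pluecker x y" "pluecker x y \<noteq> 0" using assms by (rule klinesE)
  then show ?thesis
    unfolding proj_line_def kline_def
    by (intro exI[of _ "span {x, y}"]) (simp add: kspace_pluecker pluecker_nonzero_dim del: dim_span)
qed

lemma span_in_proj_points: "v \<noteq> 0 \<Longrightarrow> span {v} \<in> proj_points"
  by (simp add: proj_points_def dim_eq_card_independent)

lemma subspace_kspace: "subspace (kspace k)"
  by (simp add: subspace_def kspace_def pluecker_linear klein_linear) (simp add: pluecker_def flip: zero_prod_def)

lemma span_in_kline: "v \<noteq> 0 \<Longrightarrow> span {v} \<in> kline k \<longleftrightarrow> v \<in> kspace k"
  using span_minimal[of "{v}" "kspace k"] span_base[of v "{v}"]
  by (auto simp: kline_def span_in_proj_points subspace_kspace)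

lemma kline_meet_iff:
  assumes "k \<in> klines" "l \<in> klines"
  shows "kline k \<inter> kline l \<noteq> {} \<longleftrightarrow> klein k l = 0"
proof -
  obtain x y where k: "k = pluecker x y" "pluecker x y \<noteq> 0" using assms(1) by (rule klinesE)
  obtain z w where l: "l = pluecker z w" "pluecker z w \<noteq> 0" using assms(2) by (rule klinesE)
  have ks: "kspace k = span {x, y}" "kspace l = span {z, w}" using k l by (simp_all add: kspace_pluecker)
  show ?thesis
  proof
    assume "kline k \<inter> kline l \<noteq> {}"
    then obtain p where p: "p \<in> proj_points" "p \<subseteq> kspace k" "p \<subseteq> kspace l" by (auto simp: kline_def)
    then have "dim p = 1" by (simp add: proj_points_def)
    \<comment> \<open>A projective point has dimension 1 and therefore contains a nonzero
      vector.\<close>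
    then have "\<not> p \<subseteq> {0}" by (metis dim_eq_0 zero_neq_one)
    then obtain v where "v \<in> p" "v \<noteq> 0" by blast
    then show "klein k l = 0" using meet_klein[of v x y z w] p ks k l by auto
  next
    assume "klein k l = 0"
    then obtain v where "v \<noteq> 0" "v \<in> span {x, y}" "v \<in> span {z, w}"
      using meet_point[of x y z w] k l by auto
    then have "span {v} \<in> kline k \<inter> kline l" by (simp add: span_in_kline ks)
    then show "kline k \<inter> kline l \<noteq> {}" by blast
  qed
qed

lemma kline_inj:
  assumes "k \<in> klines" "l \<in> klines" "kline k = kline l"
  shows "l \<in> span {k}"
proof -
  obtain x y where k: "k = pluecker x y" "pluecker x y \<noteq> 0" using assms(1) by (rule klinesE)
  obtain z w where l: "l = pluecker z w" "pluecker z w \<noteq> 0" using assms(2) by (rule klinesE)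
  have "v \<in> kspace k" if "v \<in> kspace l" for v
  proof (cases "v = 0")
    case True then show ?thesis using subspace_0[OF subspace_kspace] by simp
  next
    case False then show ?thesis using that assms(3) span_in_kline by blast
  qed
  then have "span {z, w} \<subseteq> span {x, y}" using k l by (auto simp: kspace_pluecker)
  then show ?thesis using span_base[of z "{z, w}"] span_base[of w "{z, w}"]
    unfolding k l by (intro pluecker_span) auto
qed

text \<open>Passage from Pluecker vectors to sets of points: by \<open>ns\<close> different vertices
  give different lines, so the assignment is bijective onto its image.\<close>

lemma intersection_graph_klines:
  assumes fin: "finite (verts H)" and K: "\<And>u. u \<in> verts H \<Longrightarrow> \<rho> u \<in> klines"
    and ns: "\<And>u v. u \<in> verts H \<Longrightarrow> v \<in> verts H \<Longrightarrow> u \<noteq> v \<Longrightarrow> \<rho> v \<notin> span {\<rho> u}"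
    and adj: "\<And>u v. u \<in> verts H \<Longrightarrow> v \<in> verts H \<Longrightarrow>
      {u, v} \<in> edges H \<longleftrightarrow> u \<noteq> v \<and> klein (\<rho> u) (\<rho> v) = 0"
  shows "\<exists>L. finite L \<and> (\<forall>l\<in>L. proj_line l) \<and> graph_iso H (intersection_graph L)"
proof (intro exI conjI)
  let ?f = "\<lambda>u. kline (\<rho> u)"
  let ?L = "?f ` verts H"
  show "finite ?L" using fin by simp
  show "\<forall>l\<in>?L. proj_line l" using K proj_line_kline by blast
  have inj: "inj_on ?f (verts H)" by (intro inj_onI) (metis K ns kline_inj)
  show "graph_iso H (intersection_graph ?L)"
    unfolding graph_iso_def intersection_graph_def graph.simps
  proof (intro exI conjI ballI)
    show "bij_betw ?f (verts H) ?L" using inj by (simp add: bij_betw_def)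
    fix u v assume uv: "u \<in> verts H" "v \<in> verts H"
    have "{?f u, ?f v} \<in> {{A, B} |A B. A \<in> ?L \<and> B \<in> ?L \<and> A \<noteq> B \<and> A \<inter> B \<noteq> {}} \<longleftrightarrow>
        ?f u \<noteq> ?f v \<and> ?f u \<inter> ?f v \<noteq> {}"
      using uv by (auto simp: doubleton_eq_iff)
    also have "\<dots> \<longleftrightarrow> u \<noteq> v \<and> klein (\<rho> u) (\<rho> v) = 0"
      using inj_on_eq_iff[OF inj uv] kline_meet_iff[OF K K] uv by metis
    finally show "{u, v} \<in> edges H \<longleftrightarrow> {?f u, ?f v} \<in> {{A, B} |A B. A \<in> ?L \<and> B \<in> ?L \<and> A \<noteq> B \<and> A \<inter> B \<noteq> {}}"
      using adj[OF uv] by simp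
  qed
qed

section \<open>Line graphs on the moment curve\<close>

text \<open>A Vandermonde determinant.\<close>

lemma klein_moment:
  "klein (pluecker (moment s) (moment t)) (pluecker (moment u) (moment v)) =
    (t - s) * (u - s) * (v - s) * (u - t) * (v - t) * (v - u)"
  by (simp add: moment_def pluecker_def) algebra

lemma pluecker_moment_klines: "s \<noteq> t \<Longrightarrow> pluecker (moment s) (moment t) \<in> klines"
  unfolding klines_def by (rule CollectI, intro exI conjI, rule refl)
    (simp add: moment_def pluecker_def zero_prod_def)

lemma line_graph_lines:
  fixes G :: "'a graph"
  assumes G: "finite_graph G"
  shows "\<exists>L. finite L \<and> (\<forall>l\<in>L. proj_line l) \<and> graph_iso (line_graph G) (intersection_graph L)"
proof -
  have fin: "finite (verts G)" and E: "e \<in> edges G \<Longrightarrow> e \<subseteq> verts G \<and> card e = 2" for e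
    using G by (auto simp: finite_graph_def)
  have "edges G \<subseteq> Pow (verts G)" using E by blast
  then have fin_edges: "finite (verts (line_graph G))" using fin by (simp add: line_graph_def finite_subset)
  obtain h :: "'a \<Rightarrow> nat" where h: "inj_on h (verts G)"
    using finite_imp_inj_to_nat_seg[OF fin] by blast
  define s where "s v = real (h v)" for v
  have s: "s u = s v \<longleftrightarrow> u = v" if "u \<in> verts G" "v \<in> verts G" for u v
    using h that by (auto simp: s_def inj_on_def)
  have "\<exists>a b. e = {a, b} \<and> a \<noteq> b" if "e \<in> edges G" for e
    using E[OF that] card_2_iff by metis
  then obtain a b where ab: "\<And>e. e \<in> edges G \<Longrightarrow> e = {a e, b e} \<and> a e \<noteq> b e" by metis
  have mem: "v \<in> e \<longleftrightarrow> v = a e \<or> v = b e" if "e \<in> edges G" for v e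
    using ab[OF that] by (metis insert_iff singletonD)
  have ne: "a e \<noteq> b e" if "e \<in> edges G" for e using ab[OF that] by simp
  have V: "a e \<in> verts G" "b e \<in> verts G" if "e \<in> edges G" for e
    using E[OF that] mem[OF that] by blast+
  define \<rho> where "\<rho> e = pluecker (moment (s (a e))) (moment (s (b e)))" for e
  have vl: "verts (line_graph G) = edges G" by (simp add: line_graph_def)
  have K: "\<rho> e \<in> klines" if "e \<in> verts (line_graph G)" for e
    using that ne V s unfolding vl \<rho>_def by (intro pluecker_moment_klines) auto
  have adj: "{e, e'} \<in> edges (line_graph G) \<longleftrightarrow> e \<noteq> e' \<and> klein (\<rho> e) (\<rho> e') = 0"
    if "e \<in> verts (line_graph G)" "e' \<in> verts (line_graph G)" for e e'
  proof -
    have e: "e \<in> edges G" "e' \<in> edges G" using that by (auto simp: vl)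
    have "{e, e'} \<in> edges (line_graph G) \<longleftrightarrow> e \<noteq> e' \<and> (\<exists>v. v \<in> e \<and> v \<in> e')"
      using e by (auto simp: line_graph_def doubleton_eq_iff)
    also have "(\<exists>v. v \<in> e \<and> v \<in> e') \<longleftrightarrow> a e \<in> {a e', b e'} \<or> b e \<in> {a e', b e'}"
      by (auto simp: mem[OF e(1)] mem[OF e(2)])
    also have "\<dots> \<longleftrightarrow> klein (\<rho> e) (\<rho> e') = 0"
      using ne[OF e(1)] ne[OF e(2)] V[OF e(1)] V[OF e(2)] by (auto simp: \<rho>_def klein_moment s)
    finally show ?thesis .
  qed
  \<comment> \<open>Both edges have two ends, so \<open>e\<close> has an end \<open>w\<close>
    outside \<open>e'\<close>. Joining \<open>w\<close> to a further point of the curve gives a line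
    that meets \<open>\<rho> e\<close> and misses \<open>\<rho> e'\<close>.\<close>
  have ns: "\<rho> e' \<notin> span {\<rho> e}"
    if "e \<in> verts (line_graph G)" "e' \<in> verts (line_graph G)" "e \<noteq> e'" for e e'
  proof -
    have e: "e \<in> edges G" "e' \<in> edges G" using that by (auto simp: vl)
    have "\<not> e \<subseteq> e'"
      using that(3) E[OF e(1)] E[OF e(2)] card_subset_eq[of e' e] card.infinite[of e'] by auto
    then obtain w where w: "w \<in> e" "w \<notin> e'" by blast
    \<comment> \<open>\<open>-1\<close> is a parameter not used by any vertex\<close>
    have q: "s v \<noteq> -1" for v by (simp add: s_def)
    let ?t = "pluecker (moment (s w)) (moment (-1))"
    have "w \<in> verts G" using w E e by blast
    then have "klein (\<rho> e') ?t \<noteq> 0"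
      using w(2) ne[OF e(2)] V[OF e(2)] q q[THEN not_sym] by (auto simp: \<rho>_def klein_moment s mem[OF e(2)])
    moreover have "klein ?t (\<rho> e) = 0"
      using w(1) by (auto simp: \<rho>_def mem[OF e(1)])
    ultimately show ?thesis by (intro not_in_span_klein[of _ ?t]) auto
  qed
  show ?thesis by (rule intersection_graph_klines[OF fin_edges K ns adj])
qed

section \<open>Realizing graphs\<close>

text \<open>Adjacency is a fixed relation and only the vertex set varies, so the induction passes to
  induced subgraphs. Equal vertices are exempt because every line meets itself.\<close>

definition realizable :: "('a \<Rightarrow> 'a \<Rightarrow> bool) \<Rightarrow> 'a set \<Rightarrow> bool" where
  "realizable adj V \<longleftrightarrow> (\<exists>\<rho>. inj_on \<rho> V \<and> good (\<rho> ` V) \<and>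
    (\<forall>u\<in>V. \<forall>v\<in>V. u \<noteq> v \<longrightarrow> (klein (\<rho> u) (\<rho> v) = 0 \<longleftrightarrow> adj u v)))"

text \<open>Bookkeeping shared by the three extension steps below.\<close>

lemma realizable_glue:
  assumes sym: "symp adj" and \<rho>: "inj_on \<rho> V" "\<And>u v. u \<in> V \<Longrightarrow> v \<in> V \<Longrightarrow> u \<noteq> v \<Longrightarrow> klein (\<rho> u) (\<rho> v) = 0 \<longleftrightarrow> adj u v"
    and \<sigma>: "inj_on \<sigma> C" "\<And>x y. x \<in> C \<Longrightarrow> y \<in> C \<Longrightarrow> x \<noteq> y \<Longrightarrow> klein (\<sigma> x) (\<sigma> y) = 0 \<longleftrightarrow> adj x y"
    and good: "good (\<rho> ` V \<union> \<sigma> ` C)" and disj: "V \<inter> C = {}"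
    and cross: "\<And>x u. x \<in> C \<Longrightarrow> u \<in> V \<Longrightarrow> \<sigma> x \<noteq> \<rho> u"
      "\<And>x u. x \<in> C \<Longrightarrow> u \<in> V \<Longrightarrow> klein (\<sigma> x) (\<rho> u) = 0 \<longleftrightarrow> adj u x"
  shows "realizable adj (V \<union> C)"
proof -
  define \<tau> where "\<tau> x = (if x \<in> C then \<sigma> x else \<rho> x)" for x
  have t: "x \<in> C \<Longrightarrow> \<tau> x = \<sigma> x" "x \<in> V \<Longrightarrow> \<tau> x = \<rho> x" for x using disj by (auto simp: \<tau>_def)
  have s: "adj x y \<longleftrightarrow> adj y x" for x y using sym by (auto simp: symp_def)
  have "inj_on \<tau> (V \<union> C)"
  proof (rule inj_onI)
    fix u v assume uv: "u \<in> V \<union> C" "v \<in> V \<union> C" and eq: "\<tau> u = \<tau> v"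
    consider "u \<in> V" "v \<in> V" | "u \<in> C" "v \<in> C" | "u \<in> C" "v \<in> V" | "u \<in> V" "v \<in> C"
      using uv by blast
    then show "u = v"
    proof cases
      case 1 then show ?thesis using inj_on_eq_iff[OF \<rho>(1) 1] eq t by simp
    next
      case 2 then show ?thesis using inj_on_eq_iff[OF \<sigma>(1) 2] eq t by simp
    next
      case 3 then show ?thesis using cross(1)[OF 3] eq t by simp
    next
      case 4 then show ?thesis using cross(1)[OF 4(2,1)] eq t by simp
    qed
  qed
  moreover have "\<tau> ` (V \<union> C) = \<rho> ` V \<union> \<sigma> ` C" using t by (simp add: image_Un)
  moreover have "klein (\<tau> u) (\<tau> v) = 0 \<longleftrightarrow> adj u v" if "u \<in> V \<union> C" "v \<in> V \<union> C" "u \<noteq> v" for u v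
  proof -
    consider "u \<in> V" "v \<in> V" | "u \<in> C" "v \<in> C" | "u \<in> C" "v \<in> V" | "u \<in> V" "v \<in> C"
      using \<open>u \<in> V \<union> C\<close> \<open>v \<in> V \<union> C\<close> by blast
    then show ?thesis
    proof cases
      case 1 then show ?thesis using \<rho>(2)[OF 1 \<open>u \<noteq> v\<close>] t by simp
    next
      case 2 then show ?thesis using \<sigma>(2)[OF 2 \<open>u \<noteq> v\<close>] t by simp
    next
      case 3 then show ?thesis using cross(2)[OF 3] s[of u v] t by simp
    next
      case 4 then show ?thesis
        using cross(2)[OF 4(2,1)] klein_commute[of "\<sigma> v" "\<rho> u"] t by simp
    qed
  qed
  ultimately show ?thesis unfolding realizable_def by (intro exI[of _ \<tau>]) (simp add: good)
qed

text \<open>Graph version of \<open>good_attach\<close>. The bound 2 counts neighbours other than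
  \<open>v\<close>, so it matches maximum degree 3 once \<open>v\<close> is added.\<close>

lemma realizable_insert:
  assumes sym: "symp adj" and fin: "finite V" and real: "realizable adj V" and v: "v \<notin> V"
    and card: "card {u \<in> V. adj u v} \<le> 3"
    and indep: "\<And>x y. x \<in> V \<Longrightarrow> y \<in> V \<Longrightarrow> adj x v \<Longrightarrow> adj y v \<Longrightarrow> x \<noteq> y \<Longrightarrow> \<not> adj x y"
    and deg: "\<And>a. a \<in> V \<Longrightarrow> adj a v \<Longrightarrow> card {x \<in> V. x \<noteq> a \<and> adj x a} \<le> 2"
  shows "realizable adj (insert v V)"
proof -
  obtain \<rho> where \<rho>: "inj_on \<rho> V" "good (\<rho> ` V)"
    "\<And>u v. u \<in> V \<Longrightarrow> v \<in> V \<Longrightarrow> u \<noteq> v \<Longrightarrow> klein (\<rho> u) (\<rho> v) = 0 \<longleftrightarrow> adj u v"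
    using real unfolding realizable_def by blast
  let ?N = "{u \<in> V. adj u v}"
  have card': "card (\<rho> ` A) = card A" if "A \<subseteq> V" for A
    using \<rho>(1) that card_image inj_on_subset by blast
  obtain w where w: "good (insert w (\<rho> ` V))" "w \<notin> \<rho> ` V"
    "\<And>l. l \<in> \<rho> ` V \<Longrightarrow> klein w l = 0 \<longleftrightarrow> l \<in> \<rho> ` ?N"
  proof (rule good_attach[OF \<rho>(2)])
    show "finite (\<rho> ` V)" "\<rho> ` ?N \<subseteq> \<rho> ` V" using fin by auto
    show "card (\<rho> ` ?N) \<le> 3" using card card' by (metis (no_types, lifting) mem_Collect_eq subsetI)
    show "klein x y \<noteq> 0" if "x \<in> \<rho> ` ?N" "y \<in> \<rho> ` ?N" "x \<noteq> y" for x y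
      using that \<rho>(3) indep by blast
    show "card {x \<in> \<rho> ` V. x \<noteq> a \<and> klein x a = 0} \<le> 2" if a: "a \<in> \<rho> ` ?N" for a
    proof -
      obtain a' where a': "a = \<rho> a'" "a' \<in> V" "adj a' v" using a by blast
      have "{x \<in> \<rho> ` V. x \<noteq> a \<and> klein x a = 0} \<subseteq> \<rho> ` {x \<in> V. x \<noteq> a' \<and> adj x a'}"
        using \<rho>(3) a' by blast
      then have "card {x \<in> \<rho> ` V. x \<noteq> a \<and> klein x a = 0} \<le> card (\<rho> ` {x \<in> V. x \<noteq> a' \<and> adj x a'})"
        using fin by (intro card_mono) auto
      also have "\<dots> \<le> 2" using deg[OF a'(2,3)] card'[of "{x \<in> V. x \<noteq> a' \<and> adj x a'}"] by simp
      finally show ?thesis .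
    qed
  qed blast
  have mem: "\<rho> u \<in> \<rho> ` ?N \<longleftrightarrow> adj u v" if "u \<in> V" for u
    using that inj_on_image_mem_iff[OF \<rho>(1) that, of ?N] by simp
  have "realizable adj (V \<union> {v})"
  proof (rule realizable_glue[OF sym \<rho>(1,3), where \<sigma> = "\<lambda>_. w"])
    show "klein w (\<rho> u) = 0 \<longleftrightarrow> adj u x" if "x \<in> {v}" "u \<in> V" for x u
      using that w(3)[of "\<rho> u"] mem by simp
  qed (use v w(1,2) in auto)
  then show ?thesis by simp
qed

text \<open>Graph version of \<open>good_pair\<close>: the two new lines meet in a point of the line
  of \<open>d\<close>, and both meet the line of \<open>c\<close>.\<close>

lemma realizable_diamond:
  assumes sym: "symp adj" and fin: "finite V" and real: "realizable adj V"
    and ab: "a \<notin> V" "b \<notin> V" "a \<noteq> b" "adj a b"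
    and cd: "c \<in> V" "d \<in> V" "c \<noteq> d" "\<not> adj c d"
    and nb: "\<And>u x. u \<in> V \<Longrightarrow> x \<in> {a, b} \<Longrightarrow> adj u x \<longleftrightarrow> u \<in> {c, d}"
  shows "realizable adj (V \<union> {a, b})"
proof -
  obtain \<rho> where \<rho>: "inj_on \<rho> V" "good (\<rho> ` V)"
    "\<And>u v. u \<in> V \<Longrightarrow> v \<in> V \<Longrightarrow> u \<noteq> v \<Longrightarrow> klein (\<rho> u) (\<rho> v) = 0 \<longleftrightarrow> adj u v"
    using real unfolding realizable_def by blast
  have dc: "klein (\<rho> d) (\<rho> c) \<noteq> 0" using \<rho>(3)[OF cd(1-3)] cd(4) by (simp add: klein_commute)
  have "finite (\<rho> ` V)" using fin by simp
  then obtain p q where pq: "p \<noteq> q" "klein p q = 0" "good (\<rho> ` V \<union> {p, q})"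
    "\<And>w l. w \<in> {p, q} \<Longrightarrow> l \<in> \<rho> ` V \<Longrightarrow> klein w l = 0 \<longleftrightarrow> l \<in> {\<rho> c, \<rho> d}"
    using good_pair[OF \<rho>(2) _ imageI[OF cd(1)] imageI[OF cd(2)] dc] by metis
  let ?s = "\<lambda>x. if x = a then p else q"
  have s: "adj b a" using sym ab(4) by (auto simp: symp_def)
  show ?thesis
  proof (rule realizable_glue[OF sym \<rho>(1,3), where \<sigma> = ?s])
    have "?s ` {a, b} = {p, q}" using ab(3) by auto
    then show "good (\<rho> ` V \<union> ?s ` {a, b})" using pq(3) by simp
    fix x u assume x: "x \<in> {a, b}" "u \<in> V"
    have sx: "?s x \<in> {p, q}" by simp
    have "\<rho> u \<in> {\<rho> c, \<rho> d} \<longleftrightarrow> u \<in> {c, d}"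
      using inj_on_eq_iff[OF \<rho>(1) x(2)] cd(1,2) by simp
    then show *: "klein (?s x) (\<rho> u) = 0 \<longleftrightarrow> adj u x"
      using pq(4)[OF sx imageI[OF x(2)]] nb[OF x(2,1)] by simp
    show "?s x \<noteq> \<rho> u"
    \<comment> \<open>A new line equal to an old one would meet it, so it would be the line of
      \<open>c\<close> or \<open>d\<close>; but it meets both, and these are skew.\<close>
    proof
      assume eq: "?s x = \<rho> u"
      have "klein (?s x) (?s x) = 0" by (rule klein_klines_self[OF goodD(1)[OF pq(3) UnI2[OF sx]]])
      then have m: "\<rho> u \<in> {\<rho> c, \<rho> d}" using pq(4)[OF sx imageI[OF x(2)]] eq by simp
      have "klein (?s x) (\<rho> c) = 0" "klein (?s x) (\<rho> d) = 0"
        using pq(4)[OF sx imageI[OF cd(1)]] pq(4)[OF sx imageI[OF cd(2)]] by simp_all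
      then show False using m dc klein_commute[of "\<rho> c" "\<rho> d"] unfolding eq
        by (elim insertE) simp_all
    qed
  next
    fix x y assume "x \<in> {a, b}" "y \<in> {a, b}" "x \<noteq> y"
    then show "klein (?s x) (?s y) = 0 \<longleftrightarrow> adj x y"
      using ab(3,4) s pq(2) klein_commute[of q p] by (elim insertE) simp_all
  qed (use ab pq(1) in \<open>auto simp: inj_on_def\<close>)
qed

lemma realizable_clique:
  assumes sym: "symp adj" and fin: "finite V" and real: "realizable adj V"
    and C: "finite C" "V \<inter> C = {}" "\<And>x y. x \<in> C \<Longrightarrow> y \<in> C \<Longrightarrow> x \<noteq> y \<Longrightarrow> adj x y"
    and uniq: "\<And>x u u'. x \<in> C \<Longrightarrow> u \<in> V \<Longrightarrow> u' \<in> V \<Longrightarrow> adj u x \<Longrightarrow> adj u' x \<Longrightarrow> u = u'"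
    and distinct: "\<And>x y u. x \<in> C \<Longrightarrow> y \<in> C \<Longrightarrow> u \<in> V \<Longrightarrow> adj u x \<Longrightarrow> adj u y \<Longrightarrow> x = y"
  shows "realizable adj (V \<union> C)"
proof -
  obtain \<rho> where \<rho>: "inj_on \<rho> V" "good (\<rho> ` V)"
    "\<And>u v. u \<in> V \<Longrightarrow> v \<in> V \<Longrightarrow> u \<noteq> v \<Longrightarrow> klein (\<rho> u) (\<rho> v) = 0 \<longleftrightarrow> adj u v"
    using real unfolding realizable_def by blast
  have finV: "finite (\<rho> ` V)" using fin by simp
  obtain D where D: "finite D" "card D = card C" "D \<inter> \<rho> ` V = {}" "good (\<rho> ` V \<union> D)"
    by (rule good_isolated_set[OF \<rho>(2) finV, of "card C"])
  obtain g where g: "bij_betw g C D" using finite_same_card_bij C(1) D(1,2) by metis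
  obtain f where f: "\<And>m l. m \<in> \<rho> ` V \<union> D \<Longrightarrow> l \<in> \<rho> ` V \<union> D \<Longrightarrow> klein (f m) l = 0 \<longleftrightarrow> l = m"
    "\<And>m m'. m \<in> \<rho> ` V \<union> D \<Longrightarrow> m' \<in> \<rho> ` V \<union> D \<Longrightarrow> klein (f m) (f m') = 0"
    "f ` (\<rho> ` V \<union> D) \<inter> (\<rho> ` V \<union> D) = {}" "good (\<rho> ` V \<union> D \<union> f ` (\<rho> ` V \<union> D))"
    using good_star[OF D(4) finite_UnI[OF finV D(1)]] by blast
  have "\<exists>m. (\<forall>u\<in>V. adj u x \<longleftrightarrow> \<rho> u = m) \<and> (m \<in> D \<longrightarrow> m = g x) \<and> m \<in> \<rho> ` V \<union> D" if x: "x \<in> C" for x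
  proof (cases "\<exists>u\<in>V. adj u x")
    case True
    then obtain u where u: "u \<in> V" "adj u x" by blast
    have "adj u' x \<longleftrightarrow> \<rho> u' = \<rho> u" if "u' \<in> V" for u'
      using uniq[OF x that u(1)] u inj_on_eq_iff[OF \<rho>(1) that u(1)] by blast
    then show ?thesis using u D(3) by (intro exI[of _ "\<rho> u"]) blast
  next
    case False
    have "g x \<in> D" using g x by (auto simp: bij_betw_def)
    moreover have "\<rho> u \<noteq> g x" if "u \<in> V" for u
      using \<open>g x \<in> D\<close> D(3) that by (metis disjoint_iff imageI)
    ultimately show ?thesis using False by (intro exI[of _ "g x"]) simp
  qed
  then obtain m where m: "\<And>x u. x \<in> C \<Longrightarrow> u \<in> V \<Longrightarrow> adj u x \<longleftrightarrow> \<rho> u = m x"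
    "\<And>x. x \<in> C \<Longrightarrow> m x \<in> D \<Longrightarrow> m x = g x" "\<And>x. x \<in> C \<Longrightarrow> m x \<in> \<rho> ` V \<union> D" by metis
  \<comment> \<open>Two clique vertices share no neighbour in \<open>V\<close>, and \<open>g\<close>
    gives them different dummies, so they receive different lines of the star.\<close>
  have inj_m: "x = y" if xy: "x \<in> C" "y \<in> C" "m x = m y" for x y
  proof (cases "m x \<in> D")
    case True
    then have "g x = g y" using m(2)[OF xy(1)] m(2)[OF xy(2)] xy(3) by simp
    then show ?thesis using g xy(1,2) by (auto simp: bij_betw_def inj_on_def)
  next
    case False
    then obtain u where "u \<in> V" "\<rho> u = m x" using m(3)[OF xy(1)] by (metis Un_iff imageE)
    then show ?thesis using m(1)[OF xy(1)] m(1)[OF xy(2)] distinct[OF xy(1,2)] xy(3) by simp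
  qed
  show ?thesis
  proof (rule realizable_glue[OF sym \<rho>(1,3), where \<sigma> = "\<lambda>x. f (m x)"])
    show "good (\<rho> ` V \<union> (\<lambda>x. f (m x)) ` C)" 
    proof (rule good_subset[OF f(4)], intro Un_least image_subsetI)
      fix x assume "x \<in> C"
      then show "f (m x) \<in> \<rho> ` V \<union> D \<union> f ` (\<rho> ` V \<union> D)" using m(3) by simp
    qed blast
    show "inj_on (\<lambda>x. f (m x)) C"
    proof (rule inj_onI)
      fix x y assume xy: "x \<in> C" "y \<in> C" "f (m x) = f (m y)"
      have "klein (f (m x)) (m y) = 0"
        unfolding xy(3) by (rule iffD2[OF f(1)[OF m(3)[OF xy(2)] m(3)[OF xy(2)]] refl])
      then have "m y = m x" by (rule iffD1[OF f(1)[OF m(3)[OF xy(1)] m(3)[OF xy(2)]]])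
      then show "x = y" using inj_m[OF xy(1,2)] by simp
    qed
    fix x u assume x: "x \<in> C" "u \<in> V"
    show "f (m x) \<noteq> \<rho> u" using f(3) imageI[OF m(3)[OF x(1)], of f] x(2) by blast
    show "klein (f (m x)) (\<rho> u) = 0 \<longleftrightarrow> adj u x"
      using f(1)[OF m(3)[OF x(1)], of "\<rho> u"] x m(1)[OF x] by simp
  next
    show "klein (f (m x)) (f (m y)) = 0 \<longleftrightarrow> adj x y" if "x \<in> C" "y \<in> C" "x \<noteq> y" for x y
      using f(2)[OF m(3)[OF that(1)] m(3)[OF that(2)]] C(3)[OF that] by simp
  qed (use C(2) in auto)
qed

lemma realizable_subcubic:
  assumes sym: "symp adj" and "finite V" "\<And>v. v \<in> V \<Longrightarrow> card {u \<in> V. u \<noteq> v \<and> adj u v} \<le> 3"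
  shows "realizable adj V"
  using assms(2,3)
proof (induction V rule: finite_psubset_induct)
  case (psubset V)
  let ?N = "\<lambda>v. {u \<in> V. u \<noteq> v \<and> adj u v}"
  have s: "adj y x" if "adj x y" for x y using sym that by (auto simp: symp_def)
  have fN: "finite (?N v)" for v using psubset(1) by simp
  have IH: "realizable adj (V - A)" if "A \<inter> V \<noteq> {}" for A
  proof (rule psubset.IH)
    show "V - A \<subset> V" using that by blast
    fix v assume "v \<in> V - A"
    then have "card (?N v) \<le> 3" using psubset.prems by blast
    moreover have "card {u \<in> V - A. u \<noteq> v \<and> adj u v} \<le> card (?N v)"
      by (rule card_mono[OF fN]) blast
    ultimately show "card {u \<in> V - A. u \<noteq> v \<and> adj u v} \<le> 3" by simp
  qed
  have nbrs: "adj u v \<longleftrightarrow> u \<in> A"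
    if "v \<in> V" "A \<subseteq> ?N v" "card A = 3" "u \<in> V" "u \<noteq> v" for v A u
  proof -
    have "A = ?N v" using psubset.prems[OF that(1)] that(2,3) by (intro card_seteq[OF fN]) auto
    then show ?thesis using that(4,5) by blast
  qed
  \<comment> \<open>A vertex without pairwise nonadjacent neighbours lies in a triangle. The last
    case also records that adjacent vertices never have two nonadjacent common neighbours.\<close>
  consider (diamond) x y z d where "{x, y, z, d} \<subseteq> V" "distinct [x, y, z, d]" "adj x y" "adj z x" "adj z y"
      "adj d x" "adj d y" "\<not> adj z d"
    | (indep) v where "v \<in> V" "\<forall>a\<in>?N v. \<forall>b\<in>?N v. a \<noteq> b \<longrightarrow> \<not> adj a b"
    | (empty) "V = {}"
    | (triangle) x y z where "{x, y, z} \<subseteq> V" "distinct [x, y, z]" "adj x y" "adj x z" "adj y z"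
      "\<forall>x y z d. {x, y, z, d} \<subseteq> V \<longrightarrow> distinct [x, y, z, d] \<longrightarrow> adj x y \<longrightarrow> adj z x \<longrightarrow> adj z y \<longrightarrow>
        adj d x \<longrightarrow> adj d y \<longrightarrow> adj z d"
  proof (cases "V = {}")
    case False
    then obtain v where v: "v \<in> V" by blast
    show ?thesis
    proof (cases "\<forall>a\<in>?N v. \<forall>b\<in>?N v. a \<noteq> b \<longrightarrow> \<not> adj a b")
      case True then show ?thesis using v indep by blast
    next
      case False
      then obtain a b where "a \<in> ?N v" "b \<in> ?N v" "a \<noteq> b" "adj a b" by blast
      then have "{v, a, b} \<subseteq> V" "distinct [v, a, b]" "adj v a" "adj v b" "adj a b" using v s by auto
      then show ?thesis using triangle diamond by metis
    qed
  qed (use empty in blast)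
  then show ?case
  proof cases
    case diamond
    \<comment> \<open>Both \<open>x\<close> and \<open>y\<close> already have three neighbours, so
      there are no others.\<close>
    have N: "adj u x \<longleftrightarrow> u \<in> {y, z, d}" "adj u y \<longleftrightarrow> u \<in> {x, z, d}" if "u \<in> V - {x, y}" for u
      using diamond s that by (intro nbrs; auto)+
    have "realizable adj (V - {x, y} \<union> {x, y})"
    proof (rule realizable_diamond[OF sym, where c = z and d = d])
      show "realizable adj (V - {x, y})" using diamond by (intro IH) auto
      fix u w assume u: "u \<in> V - {x, y}" "w \<in> {x, y}"
      then show "adj u w \<longleftrightarrow> u \<in> {z, d}" using N[OF u(1)] by auto
    qed (use diamond psubset(1) in auto)
    moreover have "V - {x, y} \<union> {x, y} = V" using diamond by auto
    ultimately show ?thesis by simp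
  next
    case indep
    have "realizable adj (insert v (V - {v}))"
    proof (rule realizable_insert[OF sym])
      show "realizable adj (V - {v})" using indep by (intro IH) auto
      have "{u \<in> V - {v}. adj u v} = ?N v" by blast
      then show "card {u \<in> V - {v}. adj u v} \<le> 3" using psubset.prems[OF indep(1)] by simp
      fix a assume a: "a \<in> V - {v}" "adj a v"
      have "v \<in> ?N a" using a s indep(1) by auto
      moreover have "{x \<in> V - {v}. x \<noteq> a \<and> adj x a} = ?N a - {v}" by auto
      ultimately show "card {x \<in> V - {v}. x \<noteq> a \<and> adj x a} \<le> 2"
        using psubset.prems[of a] a(1) by simp
    next
      show "finite (V - {v})" "v \<notin> V - {v}" using psubset(1) by simp_all
      show "\<not> adj x y" if "x \<in> V - {v}" "y \<in> V - {v}" "adj x v" "adj y v" "x \<noteq> y" for x y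
        using indep(2) that by simp
    qed
    moreover have "insert v (V - {v}) = V" using indep(1) by (rule insert_Diff)
    ultimately show ?thesis by simp
  next
    case empty
    then show ?thesis by (simp add: realizable_def good_empty)
  next
    case triangle
    have t: "adj x y" "adj x z" "adj y z" "adj y x" "adj z x" "adj z y" "x \<noteq> y" "x \<noteq> z" "y \<noteq> z"
      "x \<in> V" "y \<in> V" "z \<in> V"
      using triangle(1-5) s by simp_all
    have cl: "realizable adj V" if C: "C \<subseteq> V" "C \<noteq> {}" "\<And>x y. x \<in> C \<Longrightarrow> y \<in> C \<Longrightarrow> x \<noteq> y \<Longrightarrow> adj x y"
      "\<And>x u u'. x \<in> C \<Longrightarrow> u \<in> V - C \<Longrightarrow> u' \<in> V - C \<Longrightarrow> adj u x \<Longrightarrow> adj u' x \<Longrightarrow> u = u'"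
      "\<And>x y u. x \<in> C \<Longrightarrow> y \<in> C \<Longrightarrow> u \<in> V - C \<Longrightarrow> adj u x \<Longrightarrow> adj u y \<Longrightarrow> x = y" for C
    proof -
      have "finite C" using C(1) psubset(1) finite_subset by blast
      have "realizable adj (V - C)" using C(1,2) by (intro IH) auto
      then have "realizable adj (V - C \<union> C)"
        using psubset(1) \<open>finite C\<close> C(3-5) by (intro realizable_clique[OF sym]) auto
      then show ?thesis using C(1) by (simp add: Un_absorb2)
    qed
    show ?thesis
    proof (cases "\<exists>d\<in>V - {x, y, z}. adj d x \<and> adj d y \<and> adj d z")
      case True
      then obtain d where d: "d \<in> V" "d \<notin> {x, y, z}" "adj d x" "adj d y" "adj d z" by blast
      have d': "adj x d" "adj y d" "adj z d" using d(3-5) s by simp_all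
      \<comment> \<open>In a \<open>K4\<close> every vertex has its three neighbours inside, so
        nothing outside is adjacent to it.\<close>
      have no: "\<not> adj u w" if w: "w \<in> {x, y, z, d}" "u \<in> V - {x, y, z, d}" for u w
      proof -
        have "adj u w \<longleftrightarrow> u \<in> {x, y, z, d} - {w}"
        proof (rule nbrs)
          show "w \<in> V" "u \<in> V" "u \<noteq> w" using w t d(1) by auto
          show "{x, y, z, d} - {w} \<subseteq> ?N w" using w(1) t d d' by auto
          have "card {x, y, z, d} = 4" using t(7-9) d(2) by (auto simp: card_insert_if)
          then show "card ({x, y, z, d} - {w}) = 3" using w(1) by (simp add: card_Diff_singleton)
        qed
        then show ?thesis using w by blast
      qed
      show ?thesis
      proof (rule cl[of "{x, y, z, d}"])
        show "adj u w" if "u \<in> {x, y, z, d}" "w \<in> {x, y, z, d}" "u \<noteq> w" for u w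
          using that t(1-6) d(3-5) d' by auto
      qed (use t d(1) no in blast)+
    next
      case False
      have third: "\<exists>r. r \<in> {x, y, z} \<and> r \<noteq> p \<and> r \<noteq> q \<and> {x, y, z} = {p, q, r}"
        if pq: "p \<in> {x, y, z}" "q \<in> {x, y, z}" "p \<noteq> q" for p q
      proof -
        obtain r where r: "r \<in> {x, y, z}" "r \<noteq> p" "r \<noteq> q" using t(7-9) by (metis insertCI)
        have "{p, q, r} = {x, y, z}"
          using pq r t(7-9) by (intro card_subset_eq) auto
        then show ?thesis using r by auto
      qed
      \<comment> \<open>With no diamond present, an outer vertex adjacent to \<open>p\<close> and
        \<open>q\<close> is also adjacent to \<open>r\<close>, giving a \<open>K4\<close>, which is
        the case already treated.\<close>
      have two: "\<not> (adj u p \<and> adj u q)" if pq: "p \<in> {x, y, z}" "q \<in> {x, y, z}" "p \<noteq> q" "u \<in> V - {x, y, z}" for p q u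
      proof
        assume u: "adj u p \<and> adj u q"
        obtain r where r: "r \<in> {x, y, z}" "r \<noteq> p" "r \<noteq> q" "{x, y, z} = {p, q, r}"
          using third[OF pq(1-3)] by blast
        have "adj p q" "adj r p" "adj r q" using t(1-6) pq(1-3) r(1-3) by auto
        then have "adj r u"
          using triangle(6)[rule_format, of p q r u] u pq r(1-3) t(10-12) by auto
        then have "adj u w" if "w \<in> {x, y, z}" for w using s u r(4) that by auto
        then show False using False pq(4) by blast
      qed
      \<comment> \<open>Two outer neighbours together with the other two triangle vertices would
        give \<open>p\<close> degree 4.\<close>
      have one: "u = u'" if p: "p \<in> {x, y, z}" "u \<in> V - {x, y, z}" "u' \<in> V - {x, y, z}" "adj u p" "adj u' p" for p u u'
      proof (rule ccontr)
        assume "u \<noteq> u'"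
        obtain q where q: "q \<in> {x, y, z}" "p \<noteq> q" using t(7) by (metis insertCI)
        obtain r where r: "{x, y, z} = {p, q, r}" "q \<noteq> p" "r \<noteq> p" "q \<noteq> r"
          using third[OF p(1) q] q(2) by blast
        have "q \<in> {x, y, z}" "r \<in> {x, y, z}" using r(1) by auto
        then have "adj q p" "adj r p" using t(1-6) p(1) r(2-4) by auto
        moreover have "p \<in> V" "q \<in> V" "r \<in> V"
          using p(1) \<open>q \<in> {x, y, z}\<close> \<open>r \<in> {x, y, z}\<close> t(10-12) by auto
        moreover have o: "u \<in> V" "u' \<in> V" "u \<notin> {p, q, r}" "u' \<notin> {p, q, r}"
          using p(2,3) unfolding r(1) by simp_all
        ultimately have "adj u' p \<longleftrightarrow> u' \<in> {q, r, u}"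
          using p(4) r(2-4) by (intro nbrs) auto
        then show False using \<open>u \<noteq> u'\<close> p(5) o by auto
      qed
      show ?thesis
      proof (rule cl[of "{x, y, z}"])
        show "adj u w" if "u \<in> {x, y, z}" "w \<in> {x, y, z}" "u \<noteq> w" for u w
          using that t by auto
      qed (use t one two in blast)+
    qed
  qed
qed

theorem theorem6p1:
  "(\<forall>G :: 'a graph. finite_graph G \<and> max_degree G \<le> 3 \<longrightarrow>
      (\<exists>L. finite L \<and> (\<forall>l\<in>L. proj_line l) \<and> graph_iso G (intersection_graph L))) \<and>
   (\<forall>G :: 'b graph. finite_graph G \<longrightarrow>
      (\<exists>L. finite L \<and> (\<forall>l\<in>L. proj_line l) \<and> graph_iso (line_graph G) (intersection_graph L)))"
proof (intro conjI allI impI)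
  fix G :: "'a graph" assume G: "finite_graph G \<and> max_degree G \<le> 3"
  define adj where "adj u v \<longleftrightarrow> {u, v} \<in> edges G" for u v
  have fin: "finite (verts G)" and E: "\<And>e. e \<in> edges G \<Longrightarrow> e \<subseteq> verts G \<and> card e = 2"
    using G by (auto simp: finite_graph_def)
  have finE: "finite (edges G)" by (rule finite_subset[of _ "Pow (verts G)"]) (use E fin in auto)
  have "symp adj" by (simp add: symp_def adj_def insert_commute)
  then have "realizable adj (verts G)"
  proof (rule realizable_subcubic[OF _ fin])
    fix v assume v: "v \<in> verts G"
    \<comment> \<open>Distinct neighbours of \<open>v\<close> give distinct edges at
      \<open>v\<close>.\<close>
    have "card {u \<in> verts G. u \<noteq> v \<and> adj u v} \<le> card {e \<in> edges G. v \<in> e}"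
    proof (rule card_inj_on_le[of "\<lambda>u. {u, v}"])
      show "inj_on (\<lambda>u. {u, v}) {u \<in> verts G. u \<noteq> v \<and> adj u v}"
        by (auto simp: inj_on_def doubleton_eq_iff)
    qed (use finE in \<open>auto simp: adj_def\<close>)
    also have "\<dots> \<le> max_degree G"
      unfolding max_degree_def degree_def[symmetric] by (rule cSUP_upper[OF v]) (use fin in simp)
    also have "\<dots> \<le> 3" using G by simp
    finally show "card {u \<in> verts G. u \<noteq> v \<and> adj u v} \<le> 3" .
  qed
  then obtain \<rho> where \<rho>: "inj_on \<rho> (verts G)" "good (\<rho> ` verts G)"
    "\<And>u v. u \<in> verts G \<Longrightarrow> v \<in> verts G \<Longrightarrow> u \<noteq> v \<Longrightarrow> klein (\<rho> u) (\<rho> v) = 0 \<longleftrightarrow> adj u v"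
    unfolding realizable_def by blast
  show "\<exists>L. finite L \<and> (\<forall>l\<in>L. proj_line l) \<and> graph_iso G (intersection_graph L)"
  proof (rule intersection_graph_klines[OF fin])
    fix u v assume uv: "u \<in> verts G" "v \<in> verts G"
    show "\<rho> u \<in> klines" using goodD(1)[OF \<rho>(2)] uv by blast
    \<comment> \<open>For \<open>u = v\<close> both sides fail, since an edge has two
      elements.\<close>
    show "{u, v} \<in> edges G \<longleftrightarrow> u \<noteq> v \<and> klein (\<rho> u) (\<rho> v) = 0"
      using \<rho>(3)[OF uv] E[of "{u, v}"] by (cases "u = v") (auto simp: adj_def)
    assume "u \<noteq> v"
    then show "\<rho> v \<notin> span {\<rho> u}"
      using goodD(2)[OF \<rho>(2)] uv inj_on_eq_iff[OF \<rho>(1) uv] by blast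
  qed
qed (rule line_graph_lines)

end
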